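(* If $M$ is a non-degenerate Orlicz function that is twice differentiable on $(0,\infty)$, satisfies the $\Delta_2$ condition at zero, and is such that $\lim_{t\searrow0}M''(t)=\infty$, then on $\ell_M$ there is no (non-trivial) twice Gâteaux differentiable bump.
   Context: An Orlicz function is a continuous, non-decreasing, convex function $M:[0,\infty)\to[0,\infty)$ with $M(0)=0$ and $\lim_{t\to\infty}M(t)=\infty$. It is degenerate if $M(t)=0$ for some $t>0$, and non-degenerate otherwise. A non-degenerate $M$ satisfies the $\Delta_2$ condition at zero if $\liminf_{t\downarrow0}M(t)/M(2t)>0$. For a bounded real sequence $x$ put $\sigma_M(x)=\sum_{n=1}^\infty M(|x_n|)\in[0,\infty]$. The Orlicz sequence space $\ell_M$ is the linear space of all bounded real sequences $x$ with $\sigma_M(x/\rho)<\infty$ for some $\rho>0$, equipped with the norm $\|x\|=\inf\{\rho>0:\sigma_M(x/\rho)\le1\}$; it is a Banach space. A bump on a Banach space $X$ is a continuous function $b:X\to\mathbb{R}$ with bounded support (the set where it is nonzero is bounded); it is non-trivial if it is not identically zero. A function $b:X\to\mathbb{R}$ is twice Gâteaux differentiable if it is Gâteaux differentiable at every point, with derivative $b'(x)\in X^*$, and for every $x\in X$ the limit $b''(x)(h,k)=\lim_{t\to0}\frac{\langle b'(x+tk),h\rangle-\langle b'(x),h\rangle}{t}$ exists for all $h,k\in X$ and defines a bounded bilinear form on $X\times X$. *)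

theory Defs
  imports "HOL-Analysis.Analysis"
begin

section \<open>Orlicz functions\<close>

text \<open>
  A function on \<open>[0,\<infinity>)\<close> is represented by a function on \<^typ>\<open>real\<close> whose values at negative
  arguments are irrelevant.
\<close>

definition orlicz_function :: "(real \<Rightarrow> real) \<Rightarrow> bool" where
  "orlicz_function M \<longleftrightarrow>
     continuous_on {0..} M \<and> mono_on {0..} M \<and> convex_on {0..} M \<and>
     (\<forall>t\<ge>0. 0 \<le> M t) \<and> M 0 = 0 \<and> filterlim M at_top at_top"

definition degenerate :: "(real \<Rightarrow> real) \<Rightarrow> bool" where
  "degenerate M \<longleftrightarrow> (\<exists>t>0. M t = 0)"

definition Delta2_at_zero :: "(real \<Rightarrow> real) \<Rightarrow> bool" where
  "Delta2_at_zero M \<longleftrightarrow> Liminf (at_right 0) (\<lambda>t. ereal (M t / M (2 * t))) > 0"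

definition twice_differentiable_pos :: "(real \<Rightarrow> real) \<Rightarrow> bool" where
  "twice_differentiable_pos M \<longleftrightarrow>
     (\<forall>t>0. M differentiable (at t)) \<and> (\<forall>t>0. deriv M differentiable (at t))"

section \<open>Orlicz sequence spaces\<close>

text \<open>Sequences are indexed from \<open>0\<close>.\<close>

definition orlicz_modular :: "(real \<Rightarrow> real) \<Rightarrow> (nat \<Rightarrow> real) \<Rightarrow> ennreal" where
  "orlicz_modular M x = (\<Sum>n. ennreal (M \<bar>x n\<bar>))"

definition orlicz_space :: "(real \<Rightarrow> real) \<Rightarrow> (nat \<Rightarrow> real) set" where
  "orlicz_space M =
     {x. bounded (range x) \<and> (\<exists>\<rho>>0. orlicz_modular M (\<lambda>n. x n / \<rho>) < \<infinity>)}"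

text \<open>
  The value \<open>0\<close> outside the space is a convention that makes the induced distance total and
  nonnegative, as the library's notion of metric space requires.
\<close>

definition orlicz_norm :: "(real \<Rightarrow> real) \<Rightarrow> (nat \<Rightarrow> real) \<Rightarrow> real" where
  "orlicz_norm M x =
     (if x \<in> orlicz_space M
      then Inf {\<rho>. \<rho> > 0 \<and> orlicz_modular M (\<lambda>n. x n / \<rho>) \<le> 1} else 0)"

section \<open>Bumps and Gateaux differentiability on a normed sequence space\<close>

text \<open>
  A normed sequence space is given by its carrier \<open>V\<close>, closed under the pointwise operations, and
  its norm \<open>N\<close>. Functions on it are total functions on \<^typ>\<open>nat \<Rightarrow> real\<close> whose values outside
  \<open>V\<close> are irrelevant.
\<close>

definition norm_dist :: "((nat \<Rightarrow> real) \<Rightarrow> real) \<Rightarrow> (nat \<Rightarrow> real) \<Rightarrow> (nat \<Rightarrow> real) \<Rightarrow> real" where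
  "norm_dist N x y = N (\<lambda>n. x n - y n)"

definition bump :: "(nat \<Rightarrow> real) set \<Rightarrow> ((nat \<Rightarrow> real) \<Rightarrow> real) \<Rightarrow> ((nat \<Rightarrow> real) \<Rightarrow> real) \<Rightarrow> bool" where
  "bump V N b \<longleftrightarrow>
     continuous_map (Metric_space.mtopology V (norm_dist N)) euclideanreal b \<and>
     Metric_space.mbounded V (norm_dist N) {x\<in>V. b x \<noteq> 0}"

definition nontrivial_on :: "(nat \<Rightarrow> real) set \<Rightarrow> ((nat \<Rightarrow> real) \<Rightarrow> real) \<Rightarrow> bool" where
  "nontrivial_on V b \<longleftrightarrow> (\<exists>x\<in>V. b x \<noteq> 0)"

definition linear_form_on :: "(nat \<Rightarrow> real) set \<Rightarrow> ((nat \<Rightarrow> real) \<Rightarrow> real) \<Rightarrow> bool" where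
  "linear_form_on V f \<longleftrightarrow>
     (\<forall>h\<in>V. \<forall>k\<in>V. f (\<lambda>n. h n + k n) = f h + f k) \<and>
     (\<forall>c. \<forall>h\<in>V. f (\<lambda>n. c * h n) = c * f h)"

definition dual_space ::
  "(nat \<Rightarrow> real) set \<Rightarrow> ((nat \<Rightarrow> real) \<Rightarrow> real) \<Rightarrow> ((nat \<Rightarrow> real) \<Rightarrow> real) set" where
  "dual_space V N = {f. linear_form_on V f \<and> (\<exists>C. \<forall>h\<in>V. \<bar>f h\<bar> \<le> C * N h)}"

definition bounded_bilinear_form ::
  "(nat \<Rightarrow> real) set \<Rightarrow> ((nat \<Rightarrow> real) \<Rightarrow> real) \<Rightarrow> ((nat \<Rightarrow> real) \<Rightarrow> (nat \<Rightarrow> real) \<Rightarrow> real) \<Rightarrow> bool" where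
  "bounded_bilinear_form V N B \<longleftrightarrow>
     (\<forall>k\<in>V. linear_form_on V (\<lambda>h. B h k)) \<and>
     (\<forall>h\<in>V. linear_form_on V (\<lambda>k. B h k)) \<and>
     (\<exists>C. \<forall>h\<in>V. \<forall>k\<in>V. \<bar>B h k\<bar> \<le> C * N h * N k)"

definition has_gateaux_derivative ::
  "(nat \<Rightarrow> real) set \<Rightarrow> ((nat \<Rightarrow> real) \<Rightarrow> real) \<Rightarrow>
   ((nat \<Rightarrow> real) \<Rightarrow> real) \<Rightarrow> ((nat \<Rightarrow> real) \<Rightarrow> (nat \<Rightarrow> real) \<Rightarrow> real) \<Rightarrow> bool" where
  "has_gateaux_derivative V N b b' \<longleftrightarrow>
     (\<forall>x\<in>V. b' x \<in> dual_space V N \<and>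
        (\<forall>h\<in>V. ((\<lambda>t. (b (\<lambda>n. x n + t * h n) - b x) / t) \<longlongrightarrow> b' x h) (at 0)))"

definition twice_gateaux_differentiable ::
  "(nat \<Rightarrow> real) set \<Rightarrow> ((nat \<Rightarrow> real) \<Rightarrow> real) \<Rightarrow> ((nat \<Rightarrow> real) \<Rightarrow> real) \<Rightarrow> bool" where
  "twice_gateaux_differentiable V N b \<longleftrightarrow>
     (\<exists>b' b''. has_gateaux_derivative V N b b' \<and>
        (\<forall>x\<in>V. bounded_bilinear_form V N (b'' x) \<and>
           (\<forall>h\<in>V. \<forall>k\<in>V.
              ((\<lambda>t. (b' (\<lambda>n. x n + t * k n) h - b' x h) / t) \<longlongrightarrow> b'' x h k) (at 0))))"

section \<open>Orlicz sequence spaces are normed spaces\<close>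

text \<open>
  The operations \<open>Metric_space.mtopology\<close> and \<open>Metric_space.mbounded\<close> used above are meaningful
  only for a genuine metric.
\<close>

context
  fixes M :: "real \<Rightarrow> real"
  assumes M: "orlicz_function M"
begin

lemma orlicz_function_mono: "0 \<le> s \<Longrightarrow> s \<le> t \<Longrightarrow> M s \<le> M t"
  using M by (auto simp: orlicz_function_def mono_on_def)

lemma orlicz_function_nonneg: "0 \<le> t \<Longrightarrow> 0 \<le> M t"
  using M by (auto simp: orlicz_function_def)

lemma orlicz_function_convex:
  assumes "0 \<le> s" "0 \<le> t" "0 \<le> u" "0 \<le> v" "u + v = 1"
  shows "M (u * s + v * t) \<le> u * M s + v * M t"
proof -
  have "convex_on {0..} M" using M by (simp add: orlicz_function_def)
  from convex_onD[OF this, of v s t] assms show ?thesis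
    by (simp add: eq_diff_eq[symmetric])
qed

lemma orlicz_modular_mono:
  assumes "\<And>n. \<bar>x n\<bar> \<le> \<bar>y n\<bar>"
  shows "orlicz_modular M x \<le> orlicz_modular M y"
  unfolding orlicz_modular_def
  by (intro suminf_le ennreal_leI orlicz_function_mono assms) auto

lemma orlicz_modular_convex:
  assumes "0 \<le> u" "0 \<le> v" "u + v = 1"
  shows "orlicz_modular M (\<lambda>n. u * x n + v * y n)
           \<le> ennreal u * orlicz_modular M x + ennreal v * orlicz_modular M y"
proof -
  have le: "ennreal (M \<bar>u * x n + v * y n\<bar>)
          \<le> ennreal u * ennreal (M \<bar>x n\<bar>) + ennreal v * ennreal (M \<bar>y n\<bar>)" for n
  proof -
    have "\<bar>u * x n + v * y n\<bar> \<le> u * \<bar>x n\<bar> + v * \<bar>y n\<bar>"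
      using assms by (metis abs_mult abs_of_nonneg abs_triangle_ineq)
    hence "M \<bar>u * x n + v * y n\<bar> \<le> M (u * \<bar>x n\<bar> + v * \<bar>y n\<bar>)"
      by (intro orlicz_function_mono) auto
    also have "\<dots> \<le> u * M \<bar>x n\<bar> + v * M \<bar>y n\<bar>"
      by (intro orlicz_function_convex assms) auto
    finally show ?thesis
      using assms by (simp add: ennreal_mult[symmetric] ennreal_plus[symmetric]
          orlicz_function_nonneg ennreal_leI del: ennreal_plus)
  qed
  have "orlicz_modular M (\<lambda>n. u * x n + v * y n)
      \<le> (\<Sum>n. ennreal u * ennreal (M \<bar>x n\<bar>) + ennreal v * ennreal (M \<bar>y n\<bar>))"
    unfolding orlicz_modular_def by (intro suminf_le le) auto
  also have "\<dots> = ennreal u * orlicz_modular M x + ennreal v * orlicz_modular M y"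
    by (simp add: orlicz_modular_def suminf_add[symmetric])
  finally show ?thesis .
qed

lemma orlicz_modular_zero: "orlicz_modular M (\<lambda>_. 0) = 0"
  using M by (simp add: orlicz_modular_def orlicz_function_def)

abbreviation (input) adm :: "(nat \<Rightarrow> real) \<Rightarrow> real set" where
  "adm x \<equiv> {\<rho>. \<rho> > 0 \<and> orlicz_modular M (\<lambda>n. x n / \<rho>) \<le> 1}"

lemma adm_nonempty:
  assumes "x \<in> orlicz_space M"
  shows "adm x \<noteq> {}"
proof -
  obtain \<rho> where \<rho>: "\<rho> > 0" "orlicz_modular M (\<lambda>n. x n / \<rho>) < \<infinity>"
    using assms by (auto simp: orlicz_space_def)
  then obtain s where s: "s \<ge> 0" "orlicz_modular M (\<lambda>n. x n / \<rho>) = ennreal s"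
    by (cases "orlicz_modular M (\<lambda>n. x n / \<rho>)") auto
  define c where "c = max 1 s"
  have c: "c \<ge> 1" "c \<ge> s" "c > 0" by (auto simp: c_def)
  have "orlicz_modular M (\<lambda>n. (1 / c) * (x n / \<rho>) + (1 - 1 / c) * 0)
       \<le> ennreal (1 / c) * orlicz_modular M (\<lambda>n. x n / \<rho>)
         + ennreal (1 - 1 / c) * orlicz_modular M (\<lambda>_. 0)"
    using c by (intro orlicz_modular_convex) auto
  also have "\<dots> = ennreal (s / c)"
    using s c by (simp add: orlicz_modular_zero ennreal_mult[symmetric])
  also have "\<dots> \<le> ennreal 1"
    using c by (intro ennreal_leI) auto
  finally have "orlicz_modular M (\<lambda>n. x n / (c * \<rho>)) \<le> 1"
    by (simp add: mult.commute)
  with \<rho> c have "c * \<rho> \<in> adm x" by simp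
  thus ?thesis by blast
qed

lemma adm_bdd_below: "bdd_below (adm x)"
  by (rule bdd_belowI[of _ 0]) auto

lemma adm_add:
  assumes "r \<in> adm x" "s \<in> adm y"
  shows "r + s \<in> adm (\<lambda>n. x n + y n)"
proof -
  have rs: "r > 0" "s > 0" using assms by auto
  have eq: "(x n + y n) / (r + s) = (r / (r + s)) * (x n / r) + (s / (r + s)) * (y n / s)" for n
    using rs by (simp add: add_divide_distrib)
  have "orlicz_modular M (\<lambda>n. (x n + y n) / (r + s))
     \<le> ennreal (r / (r + s)) * orlicz_modular M (\<lambda>n. x n / r)
        + ennreal (s / (r + s)) * orlicz_modular M (\<lambda>n. y n / s)"
    unfolding eq using rs
    by (intro orlicz_modular_convex) (auto simp: add_divide_distrib[symmetric])
  also have "\<dots> \<le> ennreal (r / (r + s)) * 1 + ennreal (s / (r + s)) * 1"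
    using assms by (intro add_mono mult_left_mono) auto
  also have "\<dots> = 1"
    using rs by (simp add: ennreal_plus[symmetric] add_divide_distrib[symmetric] del: ennreal_plus)
  finally show ?thesis using rs by simp
qed

lemma adm_scale:
  assumes "r \<in> adm x" "c \<noteq> 0"
  shows "\<bar>c\<bar> * r \<in> adm (\<lambda>n. c * x n)"
proof -
  have "orlicz_modular M (\<lambda>n. c * x n / (\<bar>c\<bar> * r)) \<le> orlicz_modular M (\<lambda>n. x n / r)"
    using assms by (intro orlicz_modular_mono) (auto simp: abs_mult)
  also have "\<dots> \<le> 1" using assms by simp
  finally show ?thesis using assms by simp
qed

lemma orlicz_space_iff: "x \<in> orlicz_space M \<longleftrightarrow> bounded (range x) \<and> adm x \<noteq> {}"
proof
  assume "x \<in> orlicz_space M"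
  thus "bounded (range x) \<and> adm x \<noteq> {}"
    using adm_nonempty by (auto simp: orlicz_space_def)
next
  assume "bounded (range x) \<and> adm x \<noteq> {}"
  then obtain r where "bounded (range x)" "r > 0" "orlicz_modular M (\<lambda>n. x n / r) \<le> 1"
    by auto
  moreover from this have "orlicz_modular M (\<lambda>n. x n / r) < \<infinity>"
    by (metis ennreal_one_less_top infinity_ennreal_def order.strict_trans1)
  ultimately show "x \<in> orlicz_space M"
    unfolding orlicz_space_def by blast
qed

lemma zero_in_orlicz_space: "(\<lambda>_. 0) \<in> orlicz_space M"
  by (auto simp: orlicz_space_def orlicz_modular_zero intro!: exI[of _ 1])

lemma add_in_orlicz_space:
  assumes "x \<in> orlicz_space M" "y \<in> orlicz_space M"
  shows "(\<lambda>n. x n + y n) \<in> orlicz_space M"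
proof -
  have "bounded (range (\<lambda>n. x n + y n))"
    using assms bounded_plus_comp[of x UNIV y] by (auto simp: orlicz_space_def)
  moreover obtain r s where "r \<in> adm x" "s \<in> adm y"
    using assms adm_nonempty by blast
  hence "r + s \<in> adm (\<lambda>n. x n + y n)" by (rule adm_add)
  ultimately show ?thesis unfolding orlicz_space_iff by blast
qed

lemma scale_in_orlicz_space:
  assumes "x \<in> orlicz_space M"
  shows "(\<lambda>n. c * x n) \<in> orlicz_space M"
proof (cases "c = 0")
  case True
  thus ?thesis using zero_in_orlicz_space by simp
next
  case False
  have "bounded (range (\<lambda>n. c * x n))"
    using assms bounded_scaleR_comp[of x UNIV c] by (auto simp: orlicz_space_def)
  moreover obtain r where "r \<in> adm x"
    using assms adm_nonempty by blast
  hence "\<bar>c\<bar> * r \<in> adm (\<lambda>n. c * x n)" using False by (rule adm_scale)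
  ultimately show ?thesis unfolding orlicz_space_iff by blast
qed

lemma diff_in_orlicz_space:
  assumes "x \<in> orlicz_space M" "y \<in> orlicz_space M"
  shows "(\<lambda>n. x n - y n) \<in> orlicz_space M"
  using add_in_orlicz_space[OF assms(1) scale_in_orlicz_space[OF assms(2), of "-1"]] by simp

lemma orlicz_norm_eq: "x \<in> orlicz_space M \<Longrightarrow> orlicz_norm M x = Inf (adm x)"
  by (simp add: orlicz_norm_def)

lemma orlicz_norm_zero: "orlicz_norm M (\<lambda>_. 0) = 0"
proof -
  have "adm (\<lambda>_. 0) = {0<..}" by (auto simp: orlicz_modular_zero)
  thus ?thesis by (simp add: orlicz_norm_eq zero_in_orlicz_space)
qed

lemma orlicz_norm_nonneg: "0 \<le> orlicz_norm M x"
proof (cases "x \<in> orlicz_space M")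
  case True
  thus ?thesis unfolding orlicz_norm_eq[OF True] by (intro cInf_greatest adm_nonempty) auto
qed (simp add: orlicz_norm_def)

lemma orlicz_norm_le: "x \<in> orlicz_space M \<Longrightarrow> r \<in> adm x \<Longrightarrow> orlicz_norm M x \<le> r"
  unfolding orlicz_norm_eq by (intro cInf_lower adm_bdd_below)

lemma orlicz_norm_ge:
  assumes "x \<in> orlicz_space M" "\<And>r. r \<in> adm x \<Longrightarrow> a \<le> r"
  shows "a \<le> orlicz_norm M x"
  unfolding orlicz_norm_eq[OF assms(1)] by (intro cInf_greatest adm_nonempty assms)

lemma orlicz_norm_triangle:
  assumes "x \<in> orlicz_space M" "y \<in> orlicz_space M"
  shows "orlicz_norm M (\<lambda>n. x n + y n) \<le> orlicz_norm M x + orlicz_norm M y"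
proof -
  have "orlicz_norm M (\<lambda>n. x n + y n) - s \<le> orlicz_norm M x" if s: "s \<in> adm y" for s
  proof (rule orlicz_norm_ge[OF assms(1)])
    fix r assume "r \<in> adm x"
    from orlicz_norm_le[OF add_in_orlicz_space[OF assms] adm_add[OF this s]]
    show "orlicz_norm M (\<lambda>n. x n + y n) - s \<le> r" by simp
  qed
  hence "orlicz_norm M (\<lambda>n. x n + y n) - orlicz_norm M x \<le> orlicz_norm M y"
    by (intro orlicz_norm_ge[OF assms(2)]) (force simp: algebra_simps)
  thus ?thesis by simp
qed

lemma orlicz_norm_scale:
  assumes "x \<in> orlicz_space M"
  shows "orlicz_norm M (\<lambda>n. c * x n) = \<bar>c\<bar> * orlicz_norm M x"
proof (cases "c = 0")
  case True
  thus ?thesis by (simp add: orlicz_norm_zero)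
next
  case False
  have le: "orlicz_norm M (\<lambda>n. d * y n) \<le> \<bar>d\<bar> * orlicz_norm M y"
    if "d \<noteq> 0" "y \<in> orlicz_space M" for d y
  proof -
    have "orlicz_norm M (\<lambda>n. d * y n) / \<bar>d\<bar> \<le> orlicz_norm M y"
    proof (rule orlicz_norm_ge[OF that(2)])
      fix r assume "r \<in> adm y"
      from orlicz_norm_le[OF scale_in_orlicz_space[OF that(2)] adm_scale[OF this that(1)]]
      show "orlicz_norm M (\<lambda>n. d * y n) / \<bar>d\<bar> \<le> r"
        using that(1) by (simp add: divide_simps mult.commute)
    qed
    thus ?thesis using that(1) by (simp add: divide_simps mult.commute)
  qed
  have "orlicz_norm M x \<le> orlicz_norm M (\<lambda>n. c * x n) / \<bar>c\<bar>"
    using le[of "1 / c" "\<lambda>n. c * x n"] False scale_in_orlicz_space[OF assms] by simp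
  hence "\<bar>c\<bar> * orlicz_norm M x \<le> orlicz_norm M (\<lambda>n. c * x n)"
    using False by (simp add: divide_simps mult.commute)
  with le[OF False assms] show ?thesis by simp
qed

lemma orlicz_norm_eq_zero:
  assumes "x \<in> orlicz_space M"
  shows "orlicz_norm M x = 0 \<longleftrightarrow> x = (\<lambda>_. 0)"
proof
  assume *: "orlicz_norm M x = 0"
  show "x = (\<lambda>_. 0)"
  proof (rule ccontr)
    assume "x \<noteq> (\<lambda>_. 0)"
    then obtain m where m: "x m \<noteq> 0" by auto
    have "filterlim M at_top at_top" using M by (simp add: orlicz_function_def)
    hence "eventually (\<lambda>t. M t > 1) at_top" by (simp add: filterlim_at_top_dense)
    then obtain T0 where T0: "\<And>t. t \<ge> T0 \<Longrightarrow> M t > 1"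
      by (auto simp: eventually_at_top_linorder)
    define T where "T = max 1 T0"
    have T: "T > 0" "\<And>t. t \<ge> T \<Longrightarrow> M t > 1" using T0 by (auto simp: T_def)
    have "\<bar>x m\<bar> / T \<le> r" if r: "r \<in> adm x" for r
    proof -
      have "ennreal (M \<bar>x m / r\<bar>) \<le> orlicz_modular M (\<lambda>n. x n / r)"
        unfolding orlicz_modular_def
        using sum_le_suminf[of "\<lambda>n. ennreal (M \<bar>x n / r\<bar>)" "{m}"] by simp
      also have "\<dots> \<le> ennreal 1" using r by simp
      finally have "M \<bar>x m / r\<bar> \<le> 1" by (subst (asm) ennreal_le_iff) auto
      hence "\<bar>x m / r\<bar> < T" using T(2) by (meson not_le)
      thus ?thesis using r T(1) by (auto simp: divide_simps mult.commute)
    qed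
    hence "\<bar>x m\<bar> / T \<le> orlicz_norm M x"
      by (intro orlicz_norm_ge[OF assms])
    with * m T(1) show False by (simp add: divide_simps)
  qed
qed (simp add: orlicz_norm_zero)

lemma orlicz_Metric_space: "Metric_space (orlicz_space M) (norm_dist (orlicz_norm M))"
proof
  fix x y :: "nat \<Rightarrow> real"
  show "0 \<le> norm_dist (orlicz_norm M) x y"
    by (simp add: norm_dist_def orlicz_norm_nonneg)
  have "orlicz_modular M (\<lambda>n. (x n - y n) / r) = orlicz_modular M (\<lambda>n. (y n - x n) / r)" for r
    by (simp add: orlicz_modular_def abs_minus_commute)
  moreover have "bounded (range (\<lambda>n. x n - y n)) \<longleftrightarrow> bounded (range (\<lambda>n. y n - x n))"
    by (simp add: bounded_iff abs_minus_commute)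
  ultimately show "norm_dist (orlicz_norm M) x y = norm_dist (orlicz_norm M) y x"
    by (simp only: norm_dist_def orlicz_norm_def orlicz_space_def mem_Collect_eq)
next
  fix x y assume "x \<in> orlicz_space M" "y \<in> orlicz_space M"
  from orlicz_norm_eq_zero[OF diff_in_orlicz_space[OF this]]
  show "norm_dist (orlicz_norm M) x y = 0 \<longleftrightarrow> x = y"
    by (auto simp: norm_dist_def fun_eq_iff)
next
  fix x y z assume "x \<in> orlicz_space M" "y \<in> orlicz_space M" "z \<in> orlicz_space M"
  from orlicz_norm_triangle[OF diff_in_orlicz_space[OF this(1,2)] diff_in_orlicz_space[OF this(2,3)]]
  show "norm_dist (orlicz_norm M) x z
          \<le> norm_dist (orlicz_norm M) x y + norm_dist (orlicz_norm M) y z"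
    by (simp add: norm_dist_def)
qed

end

end

theory Submission
  imports Defs
begin

text \<open>
  If \<open>b\<close> is a bump, then \<open>1 / b\<^sup>2\<close> is finite exactly on a bounded set, on which the modular is
  bounded by the Delta-2 condition. A variational principle with diagonal perturbations yields
  weights \<open>c n\<close> in \<open>[1/2, 1]\<close> for which \<open>1 / (b x)\<^sup>2 - (\<Sum>n. c n * M \<bar>x n\<bar>)\<close> attains its minimum,
  at some \<open>x\<close>. Hence the second differences of \<open>1 / b\<^sup>2\<close> at \<open>x\<close> along the \<open>n\<close>-th unit vector
  dominate half of those of \<open>M \<bar>\<cdot>\<bar>\<close> at \<open>x n\<close>. As \<open>x n\<close> tends to \<open>0\<close>, the latter, divided by \<open>t\<^sup>2\<close>,
  become arbitrarily large, whereas twice Gateaux differentiability bounds the former uniformly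
  in \<open>n\<close>.
\<close>

section \<open>Orlicz sequence spaces under the Delta-2 condition\<close>

context
  fixes M :: "real \<Rightarrow> real"
  assumes orlicz: "orlicz_function M"
    and nondegenerate: "\<not> degenerate M"
    and Delta2: "Delta2_at_zero M"
begin

section \<open>Growth of the Orlicz function on bounded intervals\<close>

lemma M_mono: "0 \<le> s \<Longrightarrow> s \<le> t \<Longrightarrow> M s \<le> M t"
  using orlicz_function_mono[OF orlicz] .

lemma M_nonneg: "0 \<le> t \<Longrightarrow> 0 \<le> M t"
  using orlicz_function_nonneg[OF orlicz] .

lemma M_zero: "M 0 = 0"
  using orlicz by (simp add: orlicz_function_def)

lemma M_pos: "0 < t \<Longrightarrow> 0 < M t"
  using nondegenerate M_nonneg[of t] by (force simp: degenerate_def)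

text \<open>The liminf controls small \<open>t\<close> only. For \<open>t\<close> in
  \<open>[t0, T]\<close>, monotonicity gives \<open>M (2 * t) \<le> M (2 * T)\<close> and
  non-degeneracy gives \<open>M t \<ge> M t1 > 0\<close>, so the ratio stays bounded there as well.
  The constant \<open>K\<close> covers both ranges.\<close>

lemma Delta2_bounded:
  obtains K where "K > 0" "\<And>t. 0 \<le> t \<Longrightarrow> t \<le> T \<Longrightarrow> M (2 * t) \<le> K * M t"
proof -
  obtain c where c: "0 < ereal c" "ereal c < Liminf (at_right 0) (\<lambda>t. ereal (M t / M (2 * t)))"
    using Delta2 ereal_dense2 unfolding Delta2_at_zero_def by blast
  from less_LiminfD[OF c(2)] obtain t0
    where t0: "t0 > 0" "\<And>t. 0 < t \<Longrightarrow> t < t0 \<Longrightarrow> c < M t / M (2 * t)"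
    by (auto simp: eventually_at_right_field)
  define t1 where "t1 = t0 / 2"
  have t1: "0 < t1" "t1 < t0" using t0 by (auto simp: t1_def)
  define K where "K = max (1 / c) (M (2 * T) / M t1)"
  have "K > 0" using c by (simp add: K_def less_max_iff_disj)
  moreover have "M (2 * t) \<le> K * M t" if t: "0 \<le> t" "t \<le> T" for t
  proof (cases "t = 0")
    case False
    then have pos: "t > 0" "M t > 0" "M (2 * t) > 0" using t M_pos by auto
    show ?thesis
    proof (cases "t < t0")
      case True
      then have "M (2 * t) \<le> (1 / c) * M t"
        using t0(2)[OF pos(1)] pos c(1) by (simp add: field_simps)
      also have "\<dots> \<le> K * M t"
        using pos by (intro mult_right_mono) (auto simp: K_def)
      finally show ?thesis .
    next
      case False
      have "M (2 * t) \<le> M (2 * T)" using t by (intro M_mono) auto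
      also have "\<dots> = M (2 * T) / M t1 * M t1" using M_pos[OF t1(1)] by simp
      also have "\<dots> \<le> M (2 * T) / M t1 * M t"
        using t t1 False by (intro mult_left_mono M_mono divide_nonneg_nonneg M_nonneg) auto
      also have "\<dots> \<le> K * M t"
        using pos by (intro mult_right_mono) (auto simp: K_def)
      finally show ?thesis .
    qed
  qed (simp add: M_zero)
  ultimately show thesis by (rule that)
qed

lemma Delta2_power:
  assumes "T \<ge> 0"
  shows "\<exists>K>0. \<forall>t. 0 \<le> t \<longrightarrow> t \<le> T \<longrightarrow> M (2 ^ k * t) \<le> K * M t"
  using assms
proof (induction k arbitrary: T)
  case 0
  show ?case by (rule exI[of _ 1]) simp
next
  case (Suc k)
  obtain K1 where K1: "K1 > 0" "\<And>t. 0 \<le> t \<Longrightarrow> t \<le> T \<Longrightarrow> M (2 ^ k * t) \<le> K1 * M t"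
    using Suc by blast
  \<comment> \<open>The doubling constant depends on the range of the argument, and
    \<open>2 ^ k * t\<close> runs up to \<open>2 ^ k * T\<close>.\<close>
  obtain K2 where K2: "K2 > 0" "\<And>t. 0 \<le> t \<Longrightarrow> t \<le> 2 ^ k * T \<Longrightarrow> M (2 * t) \<le> K2 * M t"
    using Delta2_bounded by blast
  have "M (2 ^ Suc k * t) \<le> K2 * K1 * M t" if t: "0 \<le> t" "t \<le> T" for t
  proof -
    have "M (2 ^ Suc k * t) = M (2 * (2 ^ k * t))" by (simp add: mult.assoc)
    also have "\<dots> \<le> K2 * M (2 ^ k * t)" using t by (intro K2) auto
    also have "\<dots> \<le> K2 * (K1 * M t)" using K1(2)[OF t] K2(1) by (intro mult_left_mono) auto
    finally show ?thesis by (simp add: mult.assoc)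
  qed
  then show ?case using K1(1) K2(1) by (intro exI[of _ "K2 * K1"]) auto
qed

lemma Delta2_scale:
  assumes "T \<ge> 0" "c \<ge> 0"
  obtains K where "K > 0" "\<And>t. 0 \<le> t \<Longrightarrow> t \<le> T \<Longrightarrow> M (c * t) \<le> K * M t"
proof -
  obtain k :: nat where k: "c \<le> 2 ^ k"
    using real_arch_pow[of 2 c] by (auto intro: less_imp_le)
  obtain K where K: "K > 0" "\<And>t. 0 \<le> t \<Longrightarrow> t \<le> T \<Longrightarrow> M (2 ^ k * t) \<le> K * M t"
    using Delta2_power[OF assms(1)] by blast
  have "M (c * t) \<le> K * M t" if "0 \<le> t" "t \<le> T" for t
    using M_mono[of "c * t" "2 ^ k * t"] K(2)[OF that] that k assms(2)
    by (simp add: mult_right_mono)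
  with K(1) show thesis by (rule that)
qed

text \<open>A quasi-triangle inequality for the modular: the difference is at most twice the larger
  of the two absolute values, so one doubling suffices.\<close>

lemma Delta2_abs_diff:
  assumes "T \<ge> 0"
  obtains K where "K > 0"
    "\<And>s t. \<bar>s\<bar> \<le> T \<Longrightarrow> \<bar>t\<bar> \<le> T \<Longrightarrow> M \<bar>s - t\<bar> \<le> K * (M \<bar>s\<bar> + M \<bar>t\<bar>)"
proof -
  obtain K where K: "K > 0" "\<And>t. 0 \<le> t \<Longrightarrow> t \<le> T \<Longrightarrow> M (2 * t) \<le> K * M t"
    using Delta2_bounded by blast
  have "M \<bar>s - t\<bar> \<le> K * (M \<bar>s\<bar> + M \<bar>t\<bar>)" if "\<bar>s\<bar> \<le> T" "\<bar>t\<bar> \<le> T" for s t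
  proof -
    have "M \<bar>s - t\<bar> \<le> M (2 * max \<bar>s\<bar> \<bar>t\<bar>)" by (intro M_mono) auto
    also have "\<dots> \<le> K * M (max \<bar>s\<bar> \<bar>t\<bar>)" using that by (intro K) auto
    also have "\<dots> \<le> K * (M \<bar>s\<bar> + M \<bar>t\<bar>)"
      using K(1) M_nonneg by (intro mult_left_mono) (auto simp: max_def)
    finally show ?thesis .
  qed
  with K(1) show thesis by (rule that)
qed

section \<open>Norm, modular and convergence\<close>

lemma orlicz_modular_le_iff:
  assumes "r \<ge> 0"
  shows "orlicz_modular M x \<le> ennreal r \<longleftrightarrow>
    summable (\<lambda>n. M \<bar>x n\<bar>) \<and> (\<Sum>n. M \<bar>x n\<bar>) \<le> r"
proof
  assume le: "orlicz_modular M x \<le> ennreal r"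
  then have "(\<Sum>n. ennreal (M \<bar>x n\<bar>)) \<noteq> top"
    by (metis ennreal_neq_top neq_top_trans orlicz_modular_def)
  then have s: "summable (\<lambda>n. M \<bar>x n\<bar>)"
    by (intro summable_suminf_not_top) (auto intro: M_nonneg)
  with le assms show "summable (\<lambda>n. M \<bar>x n\<bar>) \<and> (\<Sum>n. M \<bar>x n\<bar>) \<le> r"
    by (simp add: orlicz_modular_def suminf_ennreal2 M_nonneg)
next
  assume "summable (\<lambda>n. M \<bar>x n\<bar>) \<and> (\<Sum>n. M \<bar>x n\<bar>) \<le> r"
  then show "orlicz_modular M x \<le> ennreal r"
    by (simp add: orlicz_modular_def suminf_ennreal2 M_nonneg ennreal_leI)
qed

text \<open>Dividing by \<open>r\<close> makes the modular at most 1, so no coordinate of the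
  quotient can pass a level beyond which \<open>M > 1\<close>. The dilation bound on
  \<open>[0, T]\<close> then undoes the division at the cost of the factor \<open>K\<close>.\<close>

lemma orlicz_norm_less_bounds:
  assumes "r > 0"
  obtains T C where "T \<ge> 0"
    "\<And>x n. x \<in> orlicz_space M \<Longrightarrow> orlicz_norm M x < r \<Longrightarrow> \<bar>x n\<bar> \<le> T"
    "\<And>x. x \<in> orlicz_space M \<Longrightarrow> orlicz_norm M x < r \<Longrightarrow> summable (\<lambda>n. M \<bar>x n\<bar>)"
    "\<And>x. x \<in> orlicz_space M \<Longrightarrow> orlicz_norm M x < r \<Longrightarrow> (\<Sum>n. M \<bar>x n\<bar>) \<le> C"
proof -
  have "filterlim M at_top at_top" using orlicz by (simp add: orlicz_function_def)
  then have "eventually (\<lambda>t. M t > 1) at_top" by (simp add: filterlim_at_top_dense)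
  then obtain T0 where T0: "\<And>t. t \<ge> T0 \<Longrightarrow> M t > 1"
    by (auto simp: eventually_at_top_linorder)
  define T where "T = max 0 T0"
  obtain K where K: "K > 0" "\<And>t. 0 \<le> t \<Longrightarrow> t \<le> T \<Longrightarrow> M (r * t) \<le> K * M t"
    using Delta2_scale[of T r] assms unfolding T_def by auto
  have *: "(\<forall>n. \<bar>x n\<bar> \<le> r * T) \<and> summable (\<lambda>n. M \<bar>x n\<bar>) \<and> (\<Sum>n. M \<bar>x n\<bar>) \<le> K"
    if x: "x \<in> orlicz_space M" "orlicz_norm M x < r" for x
  proof -
    \<comment> \<open>Strictness in \<open>orlicz_norm M x < r\<close> yields an admissible value
      below \<open>r\<close>; enlarging it to \<open>r\<close> only lowers the modular.\<close>
    obtain \<rho> where \<rho>: "\<rho> > 0" "orlicz_modular M (\<lambda>n. x n / \<rho>) \<le> 1" "\<rho> < r"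
      using cInf_lessD[OF adm_nonempty[OF orlicz x(1)]] x(2)
      unfolding orlicz_norm_eq[OF orlicz x(1)] by auto
    have "orlicz_modular M (\<lambda>n. x n / r) \<le> orlicz_modular M (\<lambda>n. x n / \<rho>)"
      using \<rho> by (intro orlicz_modular_mono[OF orlicz]) (auto simp: abs_mult frac_le)
    with \<rho>(2) have "orlicz_modular M (\<lambda>n. x n / r) \<le> ennreal 1" by simp
    then have s: "summable (\<lambda>n. M \<bar>x n / r\<bar>)" "(\<Sum>n. M \<bar>x n / r\<bar>) \<le> 1"
      unfolding orlicz_modular_le_iff[OF zero_le_one] by auto
    have t: "\<bar>x n / r\<bar> \<le> T" for n
    proof -
      have "M \<bar>x n / r\<bar> \<le> (\<Sum>n. M \<bar>x n / r\<bar>)"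
        using sum_le_suminf[OF s(1), of "{n}"] by (simp add: M_nonneg)
      then have "M \<bar>x n / r\<bar> \<le> 1" using s(2) by linarith
      then show ?thesis using T0[of "\<bar>x n / r\<bar>"] unfolding T_def by linarith
    qed
    have le: "M \<bar>x n\<bar> \<le> K * M \<bar>x n / r\<bar>" for n
      using K(2)[of "\<bar>x n / r\<bar>"] t[of n] assms by simp
    have sK: "summable (\<lambda>n. K * M \<bar>x n / r\<bar>)" using s(1) by (rule summable_mult)
    have sx: "summable (\<lambda>n. M \<bar>x n\<bar>)"
      using sK by (rule summable_comparison_test') (simp add: le M_nonneg del: abs_divide)
    have "(\<Sum>n. M \<bar>x n\<bar>) \<le> (\<Sum>n. K * M \<bar>x n / r\<bar>)" using le sx sK by (intro suminf_le)
    also have "\<dots> = K * (\<Sum>n. M \<bar>x n / r\<bar>)" using s(1) by (rule suminf_mult)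
    also have "\<dots> \<le> K" using s(2) K(1) by simp
    finally show ?thesis using sx t assms by (auto simp: field_simps)
  qed
  show thesis
    by (rule that[of "r * T" K]) (use * assms in \<open>auto simp: T_def\<close>)
qed

lemma orlicz_space_summable:
  assumes "x \<in> orlicz_space M"
  shows "summable (\<lambda>n. M \<bar>x n\<bar>)"
  using orlicz_norm_less_bounds[of "orlicz_norm M x + 1"] orlicz_norm_nonneg[OF orlicz, of x] assms
  by (metis add_pos_nonneg add.commute less_add_one zero_less_one)

lemma orlicz_spaceI:
  assumes "\<And>n. \<bar>x n\<bar> \<le> T" "summable (\<lambda>n. M \<bar>x n\<bar>)"
  shows "x \<in> orlicz_space M"
proof -
  have "orlicz_modular M (\<lambda>n. x n / 1) \<le> ennreal (\<Sum>n. M \<bar>x n\<bar>)"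
    using assms(2) by (subst orlicz_modular_le_iff) (auto intro!: suminf_nonneg M_nonneg)
  then have "orlicz_modular M (\<lambda>n. x n / 1) < \<infinity>"
    using ennreal_less_top order.strict_trans1 unfolding infinity_ennreal_def by blast
  moreover have "bounded (range x)" using assms(1) by (auto simp: bounded_iff)
  ultimately show ?thesis unfolding orlicz_space_def using zero_less_one by blast
qed

text \<open>The terms of a convergent series vanish in the limit, while non-degeneracy keeps
  \<open>M\<close> at least \<open>M e > 0\<close> on \<open>[e, \<infinity>)\<close>. This later
  places a coordinate where the second derivative of \<open>M\<close> is large.\<close>

lemma orlicz_space_tendsto_zero:
  assumes "x \<in> orlicz_space M"
  shows "x \<longlonglongrightarrow> 0"
proof (rule LIMSEQ_I)
  fix e :: real assume e: "e > 0"
  have "(\<lambda>n. M \<bar>x n\<bar>) \<longlonglongrightarrow> 0"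
    using orlicz_space_summable[OF assms] by (rule summable_LIMSEQ_zero)
  then have "eventually (\<lambda>n. M \<bar>x n\<bar> < M e) sequentially"
    using M_pos[OF e] by (rule order_tendstoD)
  then obtain k where "\<forall>n\<ge>k. M \<bar>x n\<bar> < M e" by (auto simp: eventually_sequentially)
  then show "\<exists>k. \<forall>n\<ge>k. norm (x n - 0) < e"
    using M_mono[of e] e by (fastforce simp: not_less[symmetric])
qed

text \<open>On bounded coordinates, dilation by \<open>2 / a\<close> multiplies the modular by at
  most a fixed \<open>K\<close>. Once the modular is below \<open>1 / K\<close>, the value
  \<open>a / 2\<close> is admissible, which leaves room below \<open>a\<close>.\<close>

lemma orlicz_norm_tendsto_zero:
  assumes X: "\<And>k. X k \<in> orlicz_space M" and bnd: "\<And>k n. \<bar>X k n\<bar> \<le> T"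
    and lim: "(\<lambda>k. \<Sum>n. M \<bar>X k n\<bar>) \<longlonglongrightarrow> 0"
  shows "(\<lambda>k. orlicz_norm M (X k)) \<longlonglongrightarrow> 0"
proof (rule order_tendstoI)
  fix a :: real assume "a < 0"
  then show "\<forall>\<^sub>F k in sequentially. a < orlicz_norm M (X k)"
    using orlicz_norm_nonneg[OF orlicz] by (intro always_eventually allI) (rule order_less_le_trans)
next
  fix a :: real assume a: "0 < a"
  have "T \<ge> 0" using bnd[of 0 0] by linarith
  then obtain K where K: "K > 0" "\<And>t. 0 \<le> t \<Longrightarrow> t \<le> T \<Longrightarrow> M ((2 / a) * t) \<le> K * M t"
    using Delta2_scale[of T "2 / a"] a by auto
  have "\<forall>\<^sub>F k in sequentially. (\<Sum>n. M \<bar>X k n\<bar>) < 1 / K"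
    using lim K(1) by (intro order_tendstoD) auto
  then show "\<forall>\<^sub>F k in sequentially. orlicz_norm M (X k) < a"
  proof eventually_elim
    case (elim k)
    have le: "M \<bar>X k n / (a / 2)\<bar> \<le> K * M \<bar>X k n\<bar>" for n
      using K(2)[of "\<bar>X k n\<bar>"] bnd[of k n] a by (simp add: abs_mult mult.commute)
    have sK: "summable (\<lambda>n. K * M \<bar>X k n\<bar>)"
      by (intro summable_mult orlicz_space_summable X)
    have s: "summable (\<lambda>n. M \<bar>X k n / (a / 2)\<bar>)"
      using sK by (rule summable_comparison_test') (simp add: le[simplified] M_nonneg)
    have "(\<Sum>n. M \<bar>X k n / (a / 2)\<bar>) \<le> (\<Sum>n. K * M \<bar>X k n\<bar>)"
      using le s sK by (intro suminf_le)
    also have "\<dots> = K * (\<Sum>n. M \<bar>X k n\<bar>)"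
      by (intro suminf_mult orlicz_space_summable X)
    also have "\<dots> \<le> 1" using elim K(1) by (simp add: field_simps)
    finally have "orlicz_modular M (\<lambda>n. X k n / (a / 2)) \<le> ennreal 1"
      using s orlicz_modular_le_iff[of 1 "\<lambda>n. X k n / (a / 2)"] by simp
    then have "orlicz_norm M (X k) \<le> a / 2"
      using a by (intro orlicz_norm_le[OF orlicz X]) auto
    then show ?case using a by linarith
  qed
qed

text \<open>Coordinatewise convergence settles every finite block, and the uniform tail bounds
  settle the rest. These bounds pass to \<open>x\<close> block by block, which first puts
  \<open>x\<close> in the space and then makes the modular of \<open>X k - x\<close> small.\<close>

lemma orlicz_norm_convergence:
  assumes X: "\<And>k. X k \<in> orlicz_space M" and bnd: "\<And>k n. \<bar>X k n\<bar> \<le> T"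
    and lim: "\<And>n. (\<lambda>k. X k n) \<longlonglongrightarrow> x n"
    and tails: "\<And>e. e > 0 \<Longrightarrow> \<exists>N. \<forall>\<^sub>F k in sequentially. \<forall>m. (\<Sum>n=N..<m. M \<bar>X k n\<bar>) \<le> e"
  shows "x \<in> orlicz_space M" "(\<lambda>k. norm_dist (orlicz_norm M) (X k) x) \<longlonglongrightarrow> 0"
proof -
  have cont: "continuous_on {0..} M" using orlicz by (simp add: orlicz_function_def)
  have limM: "(\<lambda>k. M \<bar>X k n\<bar>) \<longlonglongrightarrow> M \<bar>x n\<bar>" for n
    by (rule continuous_on_tendsto_compose[OF cont]) (auto intro!: tendsto_intros lim)
  have bx: "\<bar>x n\<bar> \<le> T" for n
    by (rule LIMSEQ_le_const2[OF tendsto_rabs[OF lim]]) (use bnd in auto)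
  have tail_x: "(\<Sum>n=N..<m. M \<bar>x n\<bar>) \<le> e"
    if "\<forall>\<^sub>F k in sequentially. \<forall>m. (\<Sum>n=N..<m. M \<bar>X k n\<bar>) \<le> e" for N m e
    by (rule tendsto_upperbound[OF tendsto_sum[OF limM]])
       (use that in \<open>auto elim: eventually_mono\<close>)
  obtain N1 where N1: "\<forall>\<^sub>F k in sequentially. \<forall>m. (\<Sum>n=N1..<m. M \<bar>X k n\<bar>) \<le> 1"
    using tails[of 1] by auto
  \<comment> \<open>An inequality rather than an equality, because \<open>m\<close> may lie below
    \<open>N\<close>.\<close>
  have split: "sum f {..<m} \<le> sum f {..<N} + sum f {N..<m}"
    if "\<And>n. f n \<ge> 0" for f :: "nat \<Rightarrow> real" and N m
  proof -
    have "sum f {..<m} \<le> sum f ({..<N} \<union> {N..<m})"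
      using that by (intro sum_mono2) auto
    also have "\<dots> = sum f {..<N} + sum f {N..<m}"
      by (intro sum.union_disjoint) auto
    finally show ?thesis .
  qed
  have "summable (\<lambda>n. M \<bar>x n\<bar>)"
  proof (rule summableI_nonneg_bounded)
    show "(\<Sum>n<m. M \<bar>x n\<bar>) \<le> (\<Sum>n<N1. M \<bar>x n\<bar>) + 1" for m
      using split[of "\<lambda>n. M \<bar>x n\<bar>" m N1] tail_x[OF N1, of m] by (simp add: M_nonneg)
  qed (simp add: M_nonneg)
  with bx show x: "x \<in> orlicz_space M" by (rule orlicz_spaceI)
  define D where "D = (\<lambda>k n. X k n - x n)"
  have D: "D k \<in> orlicz_space M" for k
    unfolding D_def by (rule diff_in_orlicz_space[OF orlicz X x])
  obtain K where K: "K > 0" "\<And>s t. \<bar>s\<bar> \<le> T \<Longrightarrow> \<bar>t\<bar> \<le> T \<Longrightarrow> M \<bar>s - t\<bar> \<le> K * (M \<bar>s\<bar> + M \<bar>t\<bar>)"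
    using Delta2_abs_diff[of T] order_trans[OF abs_ge_zero bx] by metis
  have "(\<lambda>k. \<Sum>n. M \<bar>D k n\<bar>) \<longlonglongrightarrow> 0"
  proof (rule order_tendstoI)
    fix a :: real assume "a < 0"
    then show "\<forall>\<^sub>F k in sequentially. a < (\<Sum>n. M \<bar>D k n\<bar>)"
      using suminf_nonneg[OF orlicz_space_summable[OF D]] M_nonneg
      by (intro always_eventually allI) (meson abs_ge_zero order_less_le_trans)
  next
    fix a :: real assume a: "0 < a"
    \<comment> \<open>The tails of \<open>X k\<close> and \<open>x\<close> together cost at most
      \<open>K * (e + e) = a / 2\<close> and the head less than \<open>a / 4\<close>, in total less
      than \<open>a\<close>.\<close>
    define e where "e = a / (4 * K)"
    have e: "e > 0" "K * (e + e) = a / 2" using a K(1) by (auto simp: e_def field_simps)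
    obtain N where N: "\<forall>\<^sub>F k in sequentially. \<forall>m. (\<Sum>n=N..<m. M \<bar>X k n\<bar>) \<le> e"
      using tails[OF e(1)] by auto
    have "(\<lambda>k. \<Sum>n<N. M \<bar>D k n\<bar>) \<longlonglongrightarrow> (\<Sum>n<N. M \<bar>x n - x n\<bar>)"
      unfolding D_def
      by (intro tendsto_sum continuous_on_tendsto_compose[OF cont]
          tendsto_rabs tendsto_diff lim tendsto_const) auto
    then have "\<forall>\<^sub>F k in sequentially. (\<Sum>n<N. M \<bar>D k n\<bar>) < a / 4"
      using a by (intro order_tendstoD) (auto simp: M_zero)
    with N show "\<forall>\<^sub>F k in sequentially. (\<Sum>n. M \<bar>D k n\<bar>) < a"
    proof eventually_elim
      case (elim k)
      have "(\<Sum>n. M \<bar>D k n\<bar>) \<le> a / 4 + a / 2"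
      proof (rule suminf_le_const[OF orlicz_space_summable[OF D]])
        fix m
        have "(\<Sum>n=N..<m. M \<bar>D k n\<bar>) \<le> (\<Sum>n=N..<m. K * (M \<bar>X k n\<bar> + M \<bar>x n\<bar>))"
          unfolding D_def by (intro sum_mono K bnd bx)
        also have "\<dots> = K * ((\<Sum>n=N..<m. M \<bar>X k n\<bar>) + (\<Sum>n=N..<m. M \<bar>x n\<bar>))"
          by (simp only: sum_distrib_left sum.distrib distrib_left)
        also have "\<dots> \<le> K * (e + e)"
          using elim(1) tail_x[OF N] K(1) by (intro mult_left_mono add_mono) auto
        finally show "(\<Sum>n<m. M \<bar>D k n\<bar>) \<le> a / 4 + a / 2"
          using split[of "\<lambda>n. M \<bar>D k n\<bar>" m N] elim(2) e(2) by (simp add: M_nonneg)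
      qed
      then show ?case using a by simp
    qed
  qed
  moreover have "\<bar>D k n\<bar> \<le> 2 * T" for k n
    using bnd[of k n] bx[of n] unfolding D_def by linarith
  ultimately have "(\<lambda>k. orlicz_norm M (D k)) \<longlonglongrightarrow> 0"
    by (intro orlicz_norm_tendsto_zero[OF D])
  then show "(\<lambda>k. norm_dist (orlicz_norm M) (X k) x) \<longlonglongrightarrow> 0"
    by (simp add: norm_dist_def D_def)
qed

section \<open>Attaining a minimum after a diagonal perturbation\<close>

definition weighted_modular :: "(nat \<Rightarrow> real) \<Rightarrow> (nat \<Rightarrow> real) \<Rightarrow> real" where
  "weighted_modular c x = (\<Sum>n. c n * M \<bar>x n\<bar>)"

text \<open>An indicator in the form of a weight: tails of the modular become weighted modulars, and
  lowering the weights beyond \<open>N\<close> becomes a subtraction.\<close>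

definition tail_weight :: "nat \<Rightarrow> nat \<Rightarrow> real" where
  "tail_weight N n = (if N \<le> n then 1 else 0)"

lemma summable_weighted:
  assumes "x \<in> orlicz_space M" "\<And>n. \<bar>c n\<bar> \<le> 1"
  shows "summable (\<lambda>n. c n * M \<bar>x n\<bar>)"
  using orlicz_space_summable[OF assms(1)]
  by (rule summable_comparison_test')
     (use assms(2) in \<open>simp add: abs_mult M_nonneg mult_left_le_one_le\<close>)

lemma weighted_modular_mono:
  assumes "x \<in> orlicz_space M" "\<And>n. \<bar>c n\<bar> \<le> 1" "\<And>n. \<bar>d n\<bar> \<le> 1" "\<And>n. c n \<le> d n"
  shows "weighted_modular c x \<le> weighted_modular d x"
  unfolding weighted_modular_def
  by (intro suminf_le summable_weighted mult_right_mono assms M_nonneg) auto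

text \<open>The penalty mechanism: subtracting the modular with the lowered weights raises a
  functional by \<open>d\<close> times the tail of its argument, hence hardly at all where that tail
  is tiny.\<close>

lemma weighted_modular_diff_tail:
  assumes "x \<in> orlicz_space M" "\<And>n. \<bar>c n\<bar> \<le> 1"
  shows "weighted_modular (\<lambda>n. c n - d * tail_weight N n) x
    = weighted_modular c x - d * weighted_modular (tail_weight N) x"
proof -
  have t: "summable (\<lambda>n. tail_weight N n * M \<bar>x n\<bar>)"
    by (rule summable_weighted[OF assms(1)]) (simp add: tail_weight_def)
  have "weighted_modular c x - d * weighted_modular (tail_weight N) x
     = (\<Sum>n. c n * M \<bar>x n\<bar> - d * (tail_weight N n * M \<bar>x n\<bar>))"
    unfolding weighted_modular_def suminf_mult[OF t, symmetric]
    by (intro suminf_diff summable_weighted assms summable_mult t)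
  then show ?thesis by (simp add: weighted_modular_def algebra_simps)
qed

text \<open>The case of empty \<open>A\<close> also supplies non-negativity of the weighted
  modular.\<close>

lemma finite_sum_le_weighted_modular:
  assumes "x \<in> orlicz_space M" "\<And>n. 0 \<le> c n" "\<And>n. c n \<le> 1" "finite A"
  shows "(\<Sum>n\<in>A. c n * M \<bar>x n\<bar>) \<le> weighted_modular c x"
  unfolding weighted_modular_def
  using assms by (intro sum_le_suminf summable_weighted) (auto simp: M_nonneg)

text \<open>Weights at most 1 are absorbed into the unweighted tail. The tail term is then the same
  for all \<open>c\<close>, which permits a limit in which weights and sequence vary
  together.\<close>

lemma weighted_modular_le_head_tail:
  assumes "x \<in> orlicz_space M" "\<And>n. 0 \<le> c n" "\<And>n. c n \<le> 1"
  shows "weighted_modular c x \<le> (\<Sum>n<N. c n * M \<bar>x n\<bar>) + weighted_modular (tail_weight N) x"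
proof -
  have c: "\<bar>c n\<bar> \<le> 1" for n using assms(2,3)[of n] by simp
  define h where "h = (\<lambda>n. if n \<in> {..<N} then c n * M \<bar>x n\<bar> else 0)"
  have h: "h sums (\<Sum>n<N. c n * M \<bar>x n\<bar>)"
    unfolding h_def by (rule sums_If_finite_set) simp
  have t: "summable (\<lambda>n. tail_weight N n * M \<bar>x n\<bar>)"
    by (rule summable_weighted[OF assms(1)]) (simp add: tail_weight_def)
  have "weighted_modular c x \<le> (\<Sum>n. h n + tail_weight N n * M \<bar>x n\<bar>)"
    unfolding weighted_modular_def
  proof (intro suminf_le summable_weighted assms(1) c summable_add sums_summable[OF h] t)
    show "\<bar>tail_weight N n\<bar> \<le> 1" for n by (simp add: tail_weight_def)
    show "c n * M \<bar>x n\<bar> \<le> h n + tail_weight N n * M \<bar>x n\<bar>" for n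
      using assms(2,3)[of n] by (auto simp: h_def tail_weight_def M_nonneg mult_left_le_one_le)
  qed
  also have "\<dots> = (\<Sum>n<N. c n * M \<bar>x n\<bar>) + weighted_modular (tail_weight N) x"
    using suminf_add[OF sums_summable[OF h] t] sums_unique[OF h]
    by (simp add: weighted_modular_def)
  finally show ?thesis .
qed

lemma small_tail:
  assumes "x \<in> orlicz_space M" "e > 0"
  obtains N where "weighted_modular (tail_weight N) x \<le> e"
proof -
  have s: "summable (\<lambda>n. M \<bar>x n\<bar>)" by (rule orlicz_space_summable[OF assms(1)])
  obtain N where N: "norm (\<Sum>i. M \<bar>x (i + N)\<bar>) < e"
    using suminf_exist_split[OF assms(2) s] by blast
  have t: "summable (\<lambda>n. tail_weight N n * M \<bar>x n\<bar>)"
    by (rule summable_weighted[OF assms(1)]) (simp add: tail_weight_def)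
  have "weighted_modular (tail_weight N) x = (\<Sum>i. M \<bar>x (i + N)\<bar>)"
    unfolding weighted_modular_def suminf_split_initial_segment[OF t, of N]
    by (simp add: tail_weight_def)
  with N have "weighted_modular (tail_weight N) x \<le> e" by simp
  then show thesis by (rule that)
qed

section \<open>Compactness and the variational principle\<close>

lemma bounded_sequences_subseq_convergent:
  fixes X :: "nat \<Rightarrow> nat \<Rightarrow> real"
  assumes "\<And>k n. \<bar>X k n\<bar> \<le> T"
  obtains r x where "strict_mono r" "\<And>n. (\<lambda>k. X (r k) n) \<longlonglongrightarrow> x n"
proof -
  \<comment> \<open>By Tychonoff this cube is compact in the product topology, whose convergence is
    coordinatewise.\<close>
  define A :: "(nat \<Rightarrow> real) set" where "A = (\<Pi>\<^sub>E n\<in>UNIV. {-T..T})"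
  have "compactin (product_topology (\<lambda>n. euclideanreal) UNIV) A"
    unfolding A_def by (subst compactin_PiE) auto
  then have "compact A" by (simp add: euclidean_product_topology)
  moreover have "X k \<in> A" for k
    using assms[of k] by (auto simp: A_def abs_le_iff minus_le_iff)
  ultimately obtain r x where r: "strict_mono r" "(X \<circ> r) \<longlonglongrightarrow> x"
    by (metis compact_imp_seq_compact seq_compactE)
  have "(\<lambda>k. X (r k) n) \<longlonglongrightarrow> x n" for n
    using continuous_on_tendsto_compose[OF continuous_on_product_coordinates r(2), of n]
    by (simp add: comp_def)
  with r(1) show thesis by (rule that)
qed

text \<open>
  The hypothesis \<open>closed\<close> says that \<open>\<phi>\<close>, extended by \<open>\<infinity>\<close> outside \<open>U\<close>, is a sequentially lower
  semicontinuous function that is continuous where finite. Each stage of the construction penalises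
  only coordinates on which the current near-minimiser is already negligible; the penalties keep the
  tails of all later near-minimisers uniformly small, so that a subsequence converges in norm.
\<close>

proposition diagonal_variational_principle:
  fixes \<phi> :: "(nat \<Rightarrow> real) \<Rightarrow> real"
  assumes U: "U \<subseteq> orlicz_space M" "U \<noteq> {}" "\<And>x. x \<in> U \<Longrightarrow> orlicz_norm M x < R" "R > 0"
    and \<phi>: "\<And>x. x \<in> U \<Longrightarrow> 0 \<le> \<phi> x"
    and closed: "\<And>X x B. \<lbrakk>\<And>k. X k \<in> U; \<And>k. \<phi> (X k) \<le> B; x \<in> orlicz_space M;
        (\<lambda>k. norm_dist (orlicz_norm M) (X k) x) \<longlonglongrightarrow> 0\<rbrakk>
      \<Longrightarrow> x \<in> U \<and> (\<lambda>k. \<phi> (X k)) \<longlonglongrightarrow> \<phi> x"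
  obtains x c where "x \<in> U" "\<And>n. 1 / 2 \<le> c n" "\<And>n. c n \<le> 1"
    "\<And>y. y \<in> U \<Longrightarrow> \<phi> x - weighted_modular c x \<le> \<phi> y - weighted_modular c y"
proof -
  obtain T C where TC: "T \<ge> 0"
    "\<And>x n. x \<in> orlicz_space M \<Longrightarrow> orlicz_norm M x < R \<Longrightarrow> \<bar>x n\<bar> \<le> T"
    "\<And>x. x \<in> orlicz_space M \<Longrightarrow> orlicz_norm M x < R \<Longrightarrow> summable (\<lambda>n. M \<bar>x n\<bar>)"
    "\<And>x. x \<in> orlicz_space M \<Longrightarrow> orlicz_norm M x < R \<Longrightarrow> (\<Sum>n. M \<bar>x n\<bar>) \<le> C"
    using orlicz_norm_less_bounds[OF U(4)] by blast
  have UV: "x \<in> orlicz_space M" if "x \<in> U" for x using U(1) that by blast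
  define F where "F = (\<lambda>c x. \<phi> x - weighted_modular c x)"
  \<comment> \<open>Stage \<open>j\<close> carries weights \<open>c\<close>, a point
    \<open>x\<close> minimising \<open>F c\<close> up to \<open>(1 / 4) ^ j\<close>, and an index
    \<open>N\<close> beyond which \<open>x\<close> has modular at most \<open>(1 / 4) ^ j\<close>.
    The margin \<open>(1 / 2) ^ Suc j\<close> above \<open>1 / 2\<close> is what later penalties may
    still consume.\<close>
  define P where "P = (\<lambda>j (c :: nat \<Rightarrow> real, x, N :: nat).
     x \<in> U \<and> (\<forall>n. 1 / 2 + (1 / 2) ^ Suc j \<le> c n \<and> c n \<le> 1) \<and>
     (\<forall>y\<in>U. F c x \<le> F c y + (1 / 4) ^ j) \<and> weighted_modular (tail_weight N) x \<le> (1 / 4) ^ j)"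
  \<comment> \<open>The penalty \<open>(1 / 2) ^ j / 4\<close> uses exactly half of the remaining
    margin. It decays more slowly than the error \<open>(1 / 4) ^ j\<close>, which is what forces
    later tails to be small.\<close>
  define Q where "Q = (\<lambda>j (c, x :: nat \<Rightarrow> real, N) (c' :: nat \<Rightarrow> real, x' :: nat \<Rightarrow> real, N' :: nat).
     c' = (\<lambda>n. c n - ((1 / 2) ^ j / 4) * tail_weight N n))"
  have modular_le: "weighted_modular c x \<le> C" if "x \<in> U" "\<And>n. 0 \<le> c n" "\<And>n. c n \<le> 1" for c x
  proof -
    have "\<bar>c n\<bar> \<le> 1" for n using that(2,3)[of n] by simp
    then have "weighted_modular c x \<le> weighted_modular (\<lambda>_. 1) x"
      using that by (intro weighted_modular_mono UV) auto
    also have "\<dots> \<le> C" using TC(4)[OF UV[OF that(1)] U(3)[OF that(1)]]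
      by (simp add: weighted_modular_def)
    finally show ?thesis .
  qed
  have near_min: "\<exists>x N. P j (c, x, N)"
    if c: "\<And>n. 1 / 2 + (1 / 2) ^ Suc j \<le> c n" "\<And>n. c n \<le> 1" for j and c :: "nat \<Rightarrow> real"
  proof -
    have c0: "0 \<le> c n" for n
      using c(1)[of n] zero_le_power[of "1 / 2 :: real" "Suc j"] by linarith
    have bdd: "bdd_below (F c ` U)"
    proof (rule bdd_belowI2)
      fix x assume x: "x \<in> U"
      show "- C \<le> F c x" using \<phi>[OF x] modular_le[of x c, OF x c0 c(2)] by (simp add: F_def)
    qed
    have "Inf (F c ` U) < Inf (F c ` U) + (1 / 4) ^ j" by simp
    then obtain x where x: "x \<in> U" "F c x < Inf (F c ` U) + (1 / 4) ^ j"
      using cInf_lessD[of "F c ` U"] U(2) by blast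
    obtain N where N: "weighted_modular (tail_weight N) x \<le> (1 / 4) ^ j"
      using small_tail[OF UV[OF x(1)], of "(1 / 4) ^ j"] by auto
    have "F c x \<le> F c y + (1 / 4) ^ j" if "y \<in> U" for y
      using x(2) cInf_lower[OF _ bdd, of "F c y"] that by fastforce
    with x(1) N c show ?thesis unfolding P_def by blast
  qed
  obtain s where s: "\<And>j. P j (s j)" "\<And>j. Q j (s j) (s (Suc j))"
  proof -
    have "\<exists>s. \<forall>j. P j (s j) \<and> Q j (s j) (s (Suc j))"
    proof (rule dependent_nat_choice)
      \<comment> \<open>At stage 0 the lower bound \<open>1 / 2 + 1 / 2\<close> forces the constant
        weight 1.\<close>
      show "\<exists>s. P 0 s" using near_min[of 0 "\<lambda>_. 1"] by auto
    next
      fix s j assume Ps: "P j s"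
      obtain c x N where s: "s = (c, x, N)" by (cases s) auto
      define c' where "c' = (\<lambda>n. c n - ((1 / 2) ^ j / 4) * tail_weight N n)"
      have c: "1 / 2 + (1 / 2) ^ Suc j \<le> c n" "c n \<le> 1" for n
        using Ps by (auto simp: P_def s)
      have "1 / 2 + (1 / 2) ^ Suc (Suc j) \<le> c' n" for n
      proof -
        have "(1 / 2 :: real) ^ Suc (Suc j) \<le> (1 / 2) ^ Suc j" by simp
        moreover have "c' n = c n" if "\<not> N \<le> n" using that by (simp add: c'_def tail_weight_def)
        moreover have "c' n = c n - (1 / 2) ^ Suc (Suc j)" if "N \<le> n"
          using that by (simp add: c'_def tail_weight_def)
        moreover have "(1 / 2 :: real) ^ Suc j = 2 * (1 / 2) ^ Suc (Suc j)" by simp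
        ultimately show ?thesis using c(1)[of n] by (cases "N \<le> n") linarith+
      qed
      moreover have "c' n \<le> 1" for n
        using c(2)[of n] by (rule order_trans[rotated]) (simp add: c'_def tail_weight_def)
      ultimately obtain x' N' where "P (Suc j) (c', x', N')"
        using near_min[of "Suc j" c'] by blast
      then show "\<exists>s'. P (Suc j) s' \<and> Q j s s'"
        by (intro exI[of _ "(c', x', N')"]) (simp add: Q_def s c'_def)
    qed
    then show thesis using that by blast
  qed
  define c where "c = (\<lambda>j. fst (s j))"
  define X where "X = (\<lambda>j. fst (snd (s j)))"
  define N where "N = (\<lambda>j. snd (snd (s j)))"
  have s_eq: "s j = (c j, X j, N j)" for j by (simp add: c_def X_def N_def)
  have XU: "X j \<in> U" and c_lower': "1 / 2 + (1 / 2) ^ Suc j \<le> c j n" and c_upper: "c j n \<le> 1"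
    and near: "y \<in> U \<Longrightarrow> F (c j) (X j) \<le> F (c j) y + (1 / 4) ^ j"
    and tail: "weighted_modular (tail_weight (N j)) (X j) \<le> (1 / 4) ^ j"
    and c_Suc: "c (Suc j) = (\<lambda>n. c j n - ((1 / 2) ^ j / 4) * tail_weight (N j) n)" for j n y
    using s(1)[of j] s(2)[of j] unfolding s_eq P_def Q_def by auto
  have c_lower: "1 / 2 \<le> c j n" for j n
    using c_lower'[of j n] zero_le_power[of "1 / 2 :: real" "Suc j"] by linarith
  have c_nonneg: "0 \<le> c j n" for j n using c_lower[of j n] by linarith
  have c_abs: "\<bar>c j n\<bar> \<le> 1" for j n using c_nonneg[of j n] c_upper[of j n] by simp
  have XV: "X j \<in> orlicz_space M" for j by (rule UV[OF XU])
  have c_dec: "decseq (\<lambda>j. c j n)" for n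
    by (rule decseq_SucI) (simp add: c_Suc tail_weight_def)
  have F_Suc: "F (c (Suc j)) y
      = F (c j) y + ((1 / 2) ^ j / 4) * weighted_modular (tail_weight (N j)) y"
    if "y \<in> U" for j y
    unfolding F_def c_Suc weighted_modular_diff_tail[OF UV[OF that] c_abs] by simp
  have F_mono: "F (c i) y \<le> F (c j) y" if "y \<in> U" "i \<le> j" for i j y
    unfolding F_def using that c_dec
    by (intro diff_left_mono weighted_modular_mono UV c_abs) (auto simp: decseq_def)
  have quarter: "0 \<le> (1 / 4 :: real) ^ j" for j by simp
  \<comment> \<open>Changing the weights raises the value at \<open>X j\<close> by at most a quarter
    of \<open>(1 / 4) ^ j\<close>, because the tail of \<open>X j\<close> is that small and the
    penalty factor is at most \<open>1 / 4\<close>. The new error counted twice adds two more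
    quarters, so three quarters of the old error are used.\<close>
  have value_dec: "decseq (\<lambda>j. F (c j) (X j) + (1 / 4) ^ j)"
  proof (rule decseq_SucI)
    fix j
    have nonneg: "0 \<le> weighted_modular (tail_weight (N j)) (X j)"
      using finite_sum_le_weighted_modular[OF XV, of "tail_weight (N j)" "{}" j]
      by (simp add: tail_weight_def)
    have "F (c (Suc j)) (X (Suc j)) \<le> F (c (Suc j)) (X j) + (1 / 4) ^ Suc j" by (rule near[OF XU])
    also have "F (c (Suc j)) (X j) \<le> F (c j) (X j) + 1 / 4 * (1 / 4) ^ j"
      unfolding F_Suc[OF XU] using tail[of j] nonneg
      by (intro add_left_mono mult_mono) (auto simp: power_le_one)
    finally show "F (c (Suc j)) (X (Suc j)) + (1 / 4) ^ Suc j \<le> F (c j) (X j) + (1 / 4) ^ j"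
      using quarter[of j] unfolding power_Suc by linarith
  qed
  \<comment> \<open>The penalty of stage \<open>i\<close> is still contained in
    \<open>F (c j) (X j)\<close>, which exceeds \<open>F (c i) (X j)\<close> by at most
    \<open>2 * (1 / 4) ^ i\<close>. Dividing by the penalty factor \<open>(1 / 2) ^ i / 4\<close>
    gives the bound.\<close>
  have tail_later: "weighted_modular (tail_weight (N i)) (X j) \<le> 8 * (1 / 2) ^ i" if "i < j" for i j
  proof -
    have "F (c i) (X j) + ((1 / 2) ^ i / 4) * weighted_modular (tail_weight (N i)) (X j)
        = F (c (Suc i)) (X j)"
      by (simp add: F_Suc[OF XU])
    also have "\<dots> \<le> F (c j) (X j)" using that by (intro F_mono XU) auto
    also have "\<dots> \<le> F (c i) (X i) + (1 / 4) ^ i"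
      using decseqD[OF value_dec, of i j] that quarter[of j] by linarith
    also have "\<dots> \<le> F (c i) (X j) + 2 * (1 / 4) ^ i" using near[OF XU, of i j] by simp
    finally have "(1 / 2) ^ i * weighted_modular (tail_weight (N i)) (X j) \<le> 8 * (1 / 4) ^ i"
      by simp
    also have "(1 / 4 :: real) ^ i = (1 / 2) ^ i * (1 / 2) ^ i"
      by (simp add: power_mult_distrib[symmetric])
    finally have "(1 / 2) ^ i * weighted_modular (tail_weight (N i)) (X j)
        \<le> (1 / 2) ^ i * (8 * (1 / 2) ^ i)" by simp
    then show ?thesis by (rule mult_left_le_imp_le) simp
  qed
  \<comment> \<open>The hypothesis \<open>closed\<close> applies only along sequences with bounded
    \<open>\<phi>\<close>.\<close>
  have \<phi>_bound: "\<phi> (X j) \<le> F (c 0) (X 0) + 1 + C" for j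
    using decseqD[OF value_dec, of 0 j] quarter[of j]
      modular_le[of "X j" "c j", OF XU c_nonneg c_upper]
    unfolding F_def power_0 by linarith
  obtain r x where r: "strict_mono r" and lim: "\<And>n. (\<lambda>k. X (r k) n) \<longlonglongrightarrow> x n"
    using bounded_sequences_subseq_convergent[of X T] TC(2)[OF XV U(3)[OF XU]] by blast
  have half: "(\<lambda>i. 8 * (1 / 2 :: real) ^ i) \<longlonglongrightarrow> 0"
    by (rule tendsto_mult_right_zero) (simp add: LIMSEQ_power_zero)
  have later: "\<forall>\<^sub>F k in sequentially. i < r k" for i
    using filterlim_subseq[OF r] by (simp add: filterlim_at_top Suc_le_eq[symmetric])
  have tails: "\<exists>N. \<forall>\<^sub>F k in sequentially. \<forall>m. (\<Sum>n=N..<m. M \<bar>X (r k) n\<bar>) \<le> e"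
    if "e > 0" for e
  proof -
    obtain i where i: "8 * (1 / 2 :: real) ^ i < e"
      using eventually_happens'[OF sequentially_bot order_tendstoD(2)[OF half \<open>e > 0\<close>]] by blast
    have "\<forall>\<^sub>F k in sequentially. \<forall>m. (\<Sum>n=N i..<m. M \<bar>X (r k) n\<bar>) \<le> e"
      using later[of i]
    proof eventually_elim
      case (elim k)
      show ?case
      proof
        fix m
        have "(\<Sum>n=N i..<m. M \<bar>X (r k) n\<bar>) = (\<Sum>n=N i..<m. tail_weight (N i) n * M \<bar>X (r k) n\<bar>)"
          by (intro sum.cong) (auto simp: tail_weight_def)
        also have "\<dots> \<le> weighted_modular (tail_weight (N i)) (X (r k))"
          by (rule finite_sum_le_weighted_modular[OF XV]) (auto simp: tail_weight_def)
        also have "\<dots> \<le> e" using tail_later[OF elim] i by simp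
        finally show "(\<Sum>n=N i..<m. M \<bar>X (r k) n\<bar>) \<le> e" .
      qed
    qed
    then show ?thesis by blast
  qed
  have xV: "x \<in> orlicz_space M" and
    dist: "(\<lambda>k. norm_dist (orlicz_norm M) (X (r k)) x) \<longlonglongrightarrow> 0"
    by (rule orlicz_norm_convergence[of "\<lambda>k. X (r k)" T x, OF XV TC(2)[OF XV U(3)[OF XU]] lim tails];
        assumption)+
  have xU: "x \<in> U" and lim\<phi>: "(\<lambda>k. \<phi> (X (r k))) \<longlonglongrightarrow> \<phi> x"
    using closed[of "\<lambda>k. X (r k)", OF XU \<phi>_bound xV dist] by blast+
  \<comment> \<open>The weights decrease and stay above \<open>1 / 2\<close>, so they converge
    coordinatewise; the limit weights lie below every \<open>c j\<close>.\<close>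
  have "\<exists>l. (\<lambda>j. c j n) \<longlonglongrightarrow> l \<and> (\<forall>j. l \<le> c j n)" for n
  proof -
    have "\<forall>j. 1 / 2 \<le> c j n" using c_lower by simp
    then obtain l where "(\<lambda>j. c j n) \<longlonglongrightarrow> l" "\<forall>j. l \<le> c j n"
      by (rule decseq_convergent[OF c_dec])
    then show ?thesis by blast
  qed
  then have "\<forall>n. \<exists>l. (\<lambda>j. c j n) \<longlonglongrightarrow> l \<and> (\<forall>j. l \<le> c j n)" by blast
  from choice[OF this] obtain d
    where d: "\<And>n. (\<lambda>j. c j n) \<longlonglongrightarrow> d n" "\<And>n j. d n \<le> c j n" by blast
  have d_lower: "1 / 2 \<le> d n" for n
    by (rule LIMSEQ_le_const[OF d(1)]) (use c_lower in auto)
  have d_upper: "d n \<le> 1" for n using d(2)[of n 0] c_upper[of 0 n] by linarith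
  have d_nonneg: "0 \<le> d n" for n using d_lower[of n] by linarith
  have d_abs: "\<bar>d n\<bar> \<le> 1" for n using d_lower[of n] d_upper[of n] by simp
  have "\<phi> x - weighted_modular d x \<le> \<phi> y - weighted_modular d y" if y: "y \<in> U" for y
  proof -
    \<comment> \<open>In the near-minimality inequality at \<open>y\<close>, the head of the modular
      up to \<open>N i\<close> is a finite sum and converges as \<open>k\<close> grows, while the
      tail is at most \<open>8 * (1 / 2) ^ i\<close> uniformly in \<open>k\<close>. Letting
      \<open>i\<close> grow afterwards removes the tail.\<close>
    have le: "\<phi> x \<le> F d y + weighted_modular d x + 8 * (1 / 2) ^ i" for i
    proof -
      have limM: "(\<lambda>k. M \<bar>X (r k) n\<bar>) \<longlonglongrightarrow> M \<bar>x n\<bar>" for n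
        using orlicz unfolding orlicz_function_def
        by (intro continuous_on_tendsto_compose[of "{0..}" M] tendsto_rabs lim) auto
      have limc: "(\<lambda>k. c (r k) n) \<longlonglongrightarrow> d n" for n
        using LIMSEQ_subseq_LIMSEQ[OF d(1) r] by (simp add: comp_def)
      have lim4: "(\<lambda>k. (1 / 4 :: real) ^ r k) \<longlonglongrightarrow> 0"
        using LIMSEQ_subseq_LIMSEQ[OF LIMSEQ_power_zero[of "1 / 4 :: real"] r]
        by (simp add: comp_def)
      have "\<forall>\<^sub>F k in sequentially. \<phi> (X (r k))
          \<le> F d y + (1 / 4) ^ r k + ((\<Sum>n<N i. c (r k) n * M \<bar>X (r k) n\<bar>) + 8 * (1 / 2) ^ i)"
        using later[of i]
      proof eventually_elim
        case (elim k)
        have "\<phi> (X (r k)) = F (c (r k)) (X (r k)) + weighted_modular (c (r k)) (X (r k))"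
          by (simp add: F_def)
        also have "F (c (r k)) (X (r k)) \<le> F (c (r k)) y + (1 / 4) ^ r k" by (rule near[OF y])
        also have "F (c (r k)) y \<le> F d y"
          unfolding F_def by (intro diff_left_mono weighted_modular_mono UV y d_abs c_abs d)
        also have "weighted_modular (c (r k)) (X (r k))
           \<le> (\<Sum>n<N i. c (r k) n * M \<bar>X (r k) n\<bar>) + weighted_modular (tail_weight (N i)) (X (r k))"
          by (rule weighted_modular_le_head_tail[OF XV c_nonneg c_upper])
        also have "weighted_modular (tail_weight (N i)) (X (r k)) \<le> 8 * (1 / 2) ^ i"
          by (rule tail_later[OF elim])
        finally show ?case by simp
      qed
      moreover have "(\<lambda>k. F d y + (1 / 4) ^ r k
           + ((\<Sum>n<N i. c (r k) n * M \<bar>X (r k) n\<bar>) + 8 * (1 / 2) ^ i))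
         \<longlonglongrightarrow> F d y + 0 + ((\<Sum>n<N i. d n * M \<bar>x n\<bar>) + 8 * (1 / 2) ^ i)"
        by (intro tendsto_add tendsto_const tendsto_sum tendsto_mult limM limc lim4)
      ultimately have "\<phi> x \<le> F d y + 0 + ((\<Sum>n<N i. d n * M \<bar>x n\<bar>) + 8 * (1 / 2) ^ i)"
        by (intro tendsto_le[OF sequentially_bot _ lim\<phi>])
      also have "(\<Sum>n<N i. d n * M \<bar>x n\<bar>) \<le> weighted_modular d x"
        by (rule finite_sum_le_weighted_modular[OF xV d_nonneg d_upper]) simp
      finally show ?thesis by simp
    qed
    have "(\<lambda>i. F d y + weighted_modular d x + 8 * (1 / 2) ^ i)
        \<longlonglongrightarrow> F d y + weighted_modular d x + 0"
      by (intro tendsto_add tendsto_const half)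
    then have "\<phi> x \<le> F d y + weighted_modular d x + 0"
      by (rule LIMSEQ_le_const) (use le in auto)
    then show ?thesis by (simp add: F_def)
  qed
  with xU d_lower d_upper show thesis by (rule that)
qed

section \<open>Unit vectors\<close>

definition unit_vector :: "nat \<Rightarrow> nat \<Rightarrow> real" where
  "unit_vector n i = (if i = n then 1 else 0)"

lemma unit_vector_in_orlicz_space: "unit_vector n \<in> orlicz_space M"
proof (rule orlicz_spaceI)
  show "summable (\<lambda>i. M \<bar>unit_vector n i\<bar>)"
    by (rule summable_finite[of "{n}"]) (auto simp: unit_vector_def M_zero)
qed (auto simp: unit_vector_def)

text \<open>The modular of a multiple of a unit vector does not see the position of its nonzero
  entry. This makes bounds on derivatives along unit vectors uniform in \<open>n\<close>.\<close>

lemma orlicz_norm_unit_vector: "orlicz_norm M (unit_vector n) = orlicz_norm M (unit_vector 0)"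
proof -
  have "orlicz_modular M (\<lambda>i. unit_vector n i / \<rho>) = ennreal (M \<bar>1 / \<rho>\<bar>)" for n \<rho>
  proof -
    have "orlicz_modular M (\<lambda>i. unit_vector n i / \<rho>)
        = (\<Sum>i\<in>{n}. ennreal (M \<bar>unit_vector n i / \<rho>\<bar>))"
      unfolding orlicz_modular_def
      by (rule suminf_finite) (auto simp: unit_vector_def M_zero)
    then show ?thesis by (simp add: unit_vector_def)
  qed
  then show ?thesis
    by (simp add: orlicz_norm_eq[OF orlicz unit_vector_in_orlicz_space])
qed

lemma line_in_orlicz_space:
  "x \<in> orlicz_space M \<Longrightarrow> (\<lambda>i. x i + t * unit_vector n i) \<in> orlicz_space M"
  by (intro add_in_orlicz_space[OF orlicz] scale_in_orlicz_space[OF orlicz]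
      unit_vector_in_orlicz_space)

lemma weighted_modular_add_unit_vector:
  assumes "x \<in> orlicz_space M" "\<And>n. \<bar>c n\<bar> \<le> 1"
  shows "weighted_modular c (\<lambda>i. x i + t * unit_vector n i)
    = weighted_modular c x + c n * (M \<bar>x n + t\<bar> - M \<bar>x n\<bar>)"
proof -
  let ?y = "\<lambda>i. x i + t * unit_vector n i"
  have "weighted_modular c ?y - weighted_modular c x
      = (\<Sum>i. c i * M \<bar>?y i\<bar> - c i * M \<bar>x i\<bar>)"
    unfolding weighted_modular_def
    by (intro suminf_diff summable_weighted line_in_orlicz_space assms)
  also have "\<dots> = (\<Sum>i\<in>{n}. c i * M \<bar>?y i\<bar> - c i * M \<bar>x i\<bar>)"
    by (rule suminf_finite) (auto simp: unit_vector_def)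
  finally show ?thesis by (simp add: unit_vector_def algebra_simps)
qed

end

section \<open>Second differences\<close>

text \<open>If \<open>L > D\<close>, the symmetrised function \<open>h\<close> has derivative
  \<open>k\<close> with \<open>k 0 = 0\<close> and slope \<open>2 * D - 2 * L < 0\<close> at 0. So
  \<open>h\<close> falls strictly below \<open>h 0\<close> to the right of 0, against the lower
  bound on second differences.\<close>

lemma second_difference_le_derivative:
  fixes G G1 :: "real \<Rightarrow> real"
  assumes "d > 0"
    and G: "\<And>t. \<bar>t\<bar> < d \<Longrightarrow> (G has_real_derivative G1 t) (at t)"
    and G1: "(G1 has_real_derivative D) (at 0)"
    and le: "\<And>t. 0 < t \<Longrightarrow> t < d \<Longrightarrow> L * t\<^sup>2 \<le> G t + G (- t) - 2 * G 0"
  shows "L \<le> D"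
proof (rule ccontr)
  assume "\<not> L \<le> D"
  then have neg: "D - (D * - 1) - 2 * L < 0" by simp
  define k where "k = (\<lambda>t. G1 t - G1 (- t) - 2 * L * t)"
  have "(G1 has_real_derivative D) (at (- 0))" using G1 by simp
  from DERIV_chain2[OF this DERIV_minus[OF DERIV_ident]]
  have "((\<lambda>t. G1 (- t)) has_real_derivative D * - 1) (at 0)" .
  from DERIV_diff[OF DERIV_diff[OF G1 this] DERIV_cmult_Id[of "2 * L"]]
  have "(k has_real_derivative D - (D * - 1) - 2 * L) (at 0)"
    unfolding k_def .
  from DERIV_neg_dec_right[OF this neg] obtain e
    where e: "e > 0" "\<And>t. 0 < t \<Longrightarrow> t < e \<Longrightarrow> k t < k 0" by auto
  define s where "s = min d e / 2"
  have s: "0 < s" "s < d" "s < e" using assms(1) e(1) by (auto simp: s_def)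
  define h where "h = (\<lambda>t. G t + G (- t) - L * t\<^sup>2)"
  have "(h has_real_derivative k t) (at t)" if t: "0 \<le> t" "t \<le> s" for t
  proof -
    have "(G has_real_derivative G1 (- t)) (at (- t))" using t s by (intro G) auto
    from DERIV_chain2[OF this DERIV_minus[OF DERIV_ident]]
    have "((\<lambda>t. G (- t)) has_real_derivative G1 (- t) * - 1) (at t)" .
    moreover have "(G has_real_derivative G1 t) (at t)" using t s by (intro G) auto
    ultimately show ?thesis
      unfolding h_def k_def by (auto intro!: derivative_eq_intros)
  qed
  from MVT2[OF s(1) this] obtain z where z: "0 < z" "z < s" "h s - h 0 = (s - 0) * k z" by auto
  have "k z < 0" using e(2)[of z] z s by (simp add: k_def)
  then have "h s < h 0" using z(3) mult_pos_neg[OF s(1), of "k z"] by simp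
  with le[OF s(1,2)] show False by (simp add: h_def)
qed

text \<open>The bound on \<open>M2\<close> makes \<open>M1 t - K * t\<close> non-decreasing, and
  integrating this gives the estimate at points away from 0. At \<open>a = 0\<close>, where the even
  extension of \<open>M\<close> may have a corner, monotonicity of \<open>M\<close> supplies the
  missing sign \<open>M1 \<ge> 0\<close>.\<close>

lemma second_difference_ge:
  fixes M M1 M2 :: "real \<Rightarrow> real"
  assumes M: "\<And>t. 0 < t \<Longrightarrow> t < \<eta> \<Longrightarrow> (M has_real_derivative M1 t) (at t)"
    and M1: "\<And>t. 0 < t \<Longrightarrow> t < \<eta> \<Longrightarrow> (M1 has_real_derivative M2 t) (at t)"
    and M2: "\<And>t. 0 < t \<Longrightarrow> t < \<eta> \<Longrightarrow> K \<le> M2 t"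
    and mono: "mono_on {0..} M" and zero: "M 0 = 0" and a: "\<bar>a\<bar> < \<eta>"
  obtains d where "d > 0"
    "\<And>t. 0 < t \<Longrightarrow> t < d \<Longrightarrow> K * t\<^sup>2 \<le> M \<bar>a + t\<bar> + M \<bar>a - t\<bar> - 2 * M \<bar>a\<bar>"
proof -
  have M1_mono: "M1 s - K * s \<le> M1 t - K * t" if st: "0 < s" "s \<le> t" "t < \<eta>" for s t
  proof (rule DERIV_nonneg_imp_nondecreasing[where f = "\<lambda>z. M1 z - K * z", OF st(2)])
    fix z assume z: "s \<le> z" "z \<le> t"
    have "((\<lambda>z. M1 z - K * z) has_real_derivative M2 z - K) (at z)"
      using z st by (auto intro!: derivative_eq_intros M1)
    then show "\<exists>y. ((\<lambda>z. M1 z - K * z) has_real_derivative y) (at z) \<and> 0 \<le> y"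
      using M2[of z] z st by auto
  qed
  have pos: "K * t\<^sup>2 \<le> M (b + t) + M (b - t) - 2 * M b"
    if t: "0 < t" "t < b" "b + t < \<eta>" for b t
  proof -
    define h where "h = (\<lambda>z. M (b + z) + M (b - z) - K * z\<^sup>2)"
    have "h 0 \<le> h t"
    proof (rule DERIV_nonneg_imp_nondecreasing[where f = h])
      fix z assume z: "0 \<le> z" "z \<le> t"
      have "((\<lambda>z. M (b + z)) has_real_derivative M1 (b + z) * 1) (at z)"
        using z t by (intro DERIV_chain2[OF M]) (auto intro!: derivative_eq_intros)
      moreover have "((\<lambda>z. M (b - z)) has_real_derivative M1 (b - z) * - 1) (at z)"
        using z t by (intro DERIV_chain2[OF M]) (auto intro!: derivative_eq_intros)
      ultimately have "(h has_real_derivative M1 (b + z) * 1 + M1 (b - z) * - 1 - K * (2 * z)) (at z)"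
        unfolding h_def by (auto intro!: derivative_eq_intros)
      moreover have "0 \<le> M1 (b + z) * 1 + M1 (b - z) * - 1 - K * (2 * z)"
        using M1_mono[of "b - z" "b + z"] z t by (simp add: algebra_simps)
      ultimately show "\<exists>y. (h has_real_derivative y) (at z) \<and> 0 \<le> y" by blast
    qed (use t in simp)
    then show ?thesis by (simp add: h_def)
  qed
  have at_zero: "K * t\<^sup>2 \<le> 2 * M t" if t: "0 < t" "t < \<eta>" for t
  proof -
    \<comment> \<open>Derivatives are available only to the right of 0, so \<open>M1\<close> and
      \<open>z\<close> are compared at some \<open>s > 0\<close> and \<open>s\<close> tends to 0;
      the same device then integrates to \<open>M\<close>.\<close>
    have M1_ge: "K * z \<le> M1 z" if z: "0 < z" "z < \<eta>" for z
    proof (rule tendsto_upperbound[OF _ _ trivial_limit_at_right_real])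
      show "((\<lambda>s. K * z - K * s) \<longlongrightarrow> K * z) (at_right 0)"
        by (auto intro!: tendsto_eq_intros)
      show "\<forall>\<^sub>F s in at_right 0. K * z - K * s \<le> M1 z"
      proof (rule eventually_at_rightI[of 0 z])
        fix s assume s: "s \<in> {0<..<z}"
        have "M1 s \<ge> 0"
          by (rule mono_on_imp_deriv_nonneg[OF mono M]) (use s z in auto)
        then show "K * z - K * s \<le> M1 z" using M1_mono[of s z] s z by simp
      qed (use z in simp)
    qed
    have M_nonneg: "0 \<le> M s" if "0 \<le> s" for s
      using mono_onD[OF mono, of 0 s] that zero by simp
    show ?thesis
    proof (rule tendsto_upperbound[OF _ _ trivial_limit_at_right_real])
      show "((\<lambda>s. K * t\<^sup>2 - K * s\<^sup>2) \<longlongrightarrow> K * t\<^sup>2) (at_right 0)"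
        by (auto intro!: tendsto_eq_intros)
      show "\<forall>\<^sub>F s in at_right 0. K * t\<^sup>2 - K * s\<^sup>2 \<le> 2 * M t"
      proof (rule eventually_at_rightI[of 0 t])
        fix s assume s: "s \<in> {0<..<t}"
        have "2 * M s - K * s\<^sup>2 \<le> 2 * M t - K * t\<^sup>2"
        proof (rule DERIV_nonneg_imp_nondecreasing[where f = "\<lambda>z. 2 * M z - K * z\<^sup>2"])
          fix z assume z: "s \<le> z" "z \<le> t"
          have "((\<lambda>z. 2 * M z - K * z\<^sup>2) has_real_derivative 2 * M1 z - K * (2 * z)) (at z)"
            using z s t by (auto intro!: derivative_eq_intros M)
          moreover have "0 \<le> 2 * M1 z - K * (2 * z)" using M1_ge[of z] z s t by simp
          ultimately show "\<exists>y. ((\<lambda>z. 2 * M z - K * z\<^sup>2) has_real_derivative y) (at z) \<and> 0 \<le> y"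
            by blast
        qed (use s in simp)
        then show "K * t\<^sup>2 - K * s\<^sup>2 \<le> 2 * M t" using M_nonneg[of s] s by simp
      qed (use t in simp)
    qed
  qed
  show thesis
  proof (cases "a = 0")
    case True
    show thesis
      by (rule that[of \<eta>]) (use a at_zero True zero in auto)
  next
    case False
    \<comment> \<open>This radius keeps \<open>a + t\<close> and \<open>a - t\<close> on the same
      side of 0 as \<open>a\<close> and within distance \<open>\<eta>\<close> of 0; for negative
      \<open>a\<close> the two points swap roles.\<close>
    show thesis
    proof (rule that[of "min \<bar>a\<bar> (\<eta> - \<bar>a\<bar>)"])
      fix t assume t: "0 < t" "t < min \<bar>a\<bar> (\<eta> - \<bar>a\<bar>)"
      show "K * t\<^sup>2 \<le> M \<bar>a + t\<bar> + M \<bar>a - t\<bar> - 2 * M \<bar>a\<bar>"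
      proof (cases "a > 0")
        case True
        then have "\<bar>a + t\<bar> = \<bar>a\<bar> + t" "\<bar>a - t\<bar> = \<bar>a\<bar> - t" using t by auto
        then show ?thesis using pos[of t "\<bar>a\<bar>"] t by simp
      next
        case False
        then have "\<bar>a + t\<bar> = \<bar>a\<bar> - t" "\<bar>a - t\<bar> = \<bar>a\<bar> + t" using t by auto
        then show ?thesis using pos[of t "\<bar>a\<bar>"] t by simp
      qed
    qed (use False a in simp)
  qed
qed

text \<open>Continuity keeps \<open>g\<close> nonzero near 0, which gives the first derivative on a
  whole interval. Since \<open>g1\<close> is known to be differentiable only at 0, the second
  derivative is taken there alone.\<close>

lemma has_second_derivative_inverse_square:
  fixes g g1 :: "real \<Rightarrow> real"
  assumes g: "\<And>t. (g has_real_derivative g1 t) (at t)"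
    and g1: "(g1 has_real_derivative B) (at 0)" and nz: "g 0 \<noteq> 0"
  obtains d where "d > 0" "\<And>t. \<bar>t\<bar> < d \<Longrightarrow> g t \<noteq> 0"
    "\<And>t. \<bar>t\<bar> < d \<Longrightarrow> ((\<lambda>t. 1 / (g t)\<^sup>2) has_real_derivative - 2 * g1 t / (g t) ^ 3) (at t)"
    "((\<lambda>t. - 2 * g1 t / (g t) ^ 3) has_real_derivative
        6 * (g1 0)\<^sup>2 / (g 0) ^ 4 - 2 * B / (g 0) ^ 3) (at 0)"
proof -
  have "isCont g 0" using g DERIV_isCont by blast
  then have "\<forall>\<^sub>F t in at 0. g t \<noteq> 0"
    using nz tendsto_imp_eventually_ne unfolding isCont_def by blast
  then obtain d where d: "d > 0" "\<And>t. t \<noteq> 0 \<Longrightarrow> \<bar>t\<bar> < d \<Longrightarrow> g t \<noteq> 0"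
    by (auto simp: eventually_at dist_real_def)
  have ne: "g t \<noteq> 0" if "\<bar>t\<bar> < d" for t using d(2)[of t] that nz by (cases "t = 0") auto
  show thesis
  proof (rule that[OF d(1) ne])
    fix t assume "\<bar>t\<bar> < d"
    then have "g t \<noteq> 0" by (rule ne)
    then show "((\<lambda>t. 1 / (g t)\<^sup>2) has_real_derivative - 2 * g1 t / (g t) ^ 3) (at t)"
      by (auto intro!: derivative_eq_intros g simp: field_simps eval_nat_numeral)
  next
    show "((\<lambda>t. - 2 * g1 t / (g t) ^ 3) has_real_derivative
        6 * (g1 0)\<^sup>2 / (g 0) ^ 4 - 2 * B / (g 0) ^ 3) (at 0)"
      using nz by (auto intro!: derivative_eq_intros g g1 simp: field_simps eval_nat_numeral)
  qed auto
qed

section \<open>Differentiable bumps\<close>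

text \<open>The variational principle applies with \<open>1 / (b x)\<^sup>2\<close> on the set where
  \<open>b\<close> is nonzero: boundedness of the support places this set in a ball, and the blow-up
  at its boundary gives the closedness hypothesis.\<close>

lemma bump_perturbed_minimum:
  assumes M: "orlicz_function M" "\<not> degenerate M" "Delta2_at_zero M"
    and bump: "bump (orlicz_space M) (orlicz_norm M) b"
    and nontrivial: "nontrivial_on (orlicz_space M) b"
  obtains x c where "x \<in> orlicz_space M" "b x \<noteq> 0" "\<And>n. 1 / 2 \<le> c n" "\<And>n. c n \<le> 1"
    "\<And>y. y \<in> orlicz_space M \<Longrightarrow> b y \<noteq> 0 \<Longrightarrow>
      1 / (b x)\<^sup>2 - weighted_modular M c x \<le> 1 / (b y)\<^sup>2 - weighted_modular M c y"
proof -
  interpret Metric_space "orlicz_space M" "norm_dist (orlicz_norm M)"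
    by (rule orlicz_Metric_space[OF M(1)])
  define U where "U = {x \<in> orlicz_space M. b x \<noteq> 0}"
  obtain x0 where x0: "x0 \<in> U"
    using nontrivial by (auto simp: nontrivial_on_def U_def)
  obtain B where B: "B > 0" "\<And>x. x \<in> U \<Longrightarrow> norm_dist (orlicz_norm M) x x0 \<le> B"
    using bump x0 unfolding bump_def mbounded_alt_pos U_def by blast
  define R where "R = B + orlicz_norm M x0 + 1"
  have "R > 0" using B(1) orlicz_norm_nonneg[OF M(1), of x0] by (simp add: R_def)
  have R: "orlicz_norm M x < R" if x: "x \<in> U" for x
  proof -
    have "orlicz_norm M (\<lambda>n. (x n - x0 n) + x0 n)
        \<le> orlicz_norm M (\<lambda>n. x n - x0 n) + orlicz_norm M x0"
      using x x0 by (intro orlicz_norm_triangle[OF M(1)] diff_in_orlicz_space[OF M(1)])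
        (auto simp: U_def)
    then show ?thesis using B(2)[OF x] by (simp add: norm_dist_def R_def)
  qed
  have closed: "x \<in> U \<and> (\<lambda>k. 1 / (b (X k))\<^sup>2) \<longlonglongrightarrow> 1 / (b x)\<^sup>2"
    if X: "\<And>k. X k \<in> U" and le: "\<And>k. 1 / (b (X k))\<^sup>2 \<le> B" and x: "x \<in> orlicz_space M"
      and lim: "(\<lambda>k. norm_dist (orlicz_norm M) (X k) x) \<longlonglongrightarrow> 0" for X x B
  proof -
    have "limitin mtopology X x sequentially"
      unfolding limitin_metric_dist_null using X x lim by (auto simp: U_def)
    then have b: "(\<lambda>k. b (X k)) \<longlonglongrightarrow> b x"
      using continuous_map_limit[of mtopology euclideanreal b X x sequentially] bump
      by (simp add: bump_def comp_def)
    \<comment> \<open>A bound on \<open>1 / b\<^sup>2\<close> keeps \<open>b (X k)\<close> away from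
      0; written without division, it passes to the limit and shows
      \<open>b x \<noteq> 0\<close>.\<close>
    have "1 \<le> B * (b x)\<^sup>2"
    proof (rule LIMSEQ_le_const)
      show "(\<lambda>k. B * (b (X k))\<^sup>2) \<longlonglongrightarrow> B * (b x)\<^sup>2" by (intro tendsto_intros b)
      show "\<exists>m. \<forall>k\<ge>m. 1 \<le> B * (b (X k))\<^sup>2"
        using le X by (auto simp: U_def divide_le_eq)
    qed
    then have "b x \<noteq> 0" by auto
    then show ?thesis using x b by (auto simp: U_def intro!: tendsto_intros)
  qed
  have U: "U \<subseteq> orlicz_space M" "U \<noteq> {}" using x0 by (auto simp: U_def)
  show thesis
  proof (rule diagonal_variational_principle[OF M, where \<phi> = "\<lambda>x. 1 / (b x)\<^sup>2",
        OF U R \<open>R > 0\<close> _ closed])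
    fix x c
    assume "x \<in> U" "\<And>n. 1 / 2 \<le> c n" "\<And>n. c n \<le> 1"
      "\<And>y. y \<in> U \<Longrightarrow> 1 / (b x)\<^sup>2 - weighted_modular M c x \<le> 1 / (b y)\<^sup>2 - weighted_modular M c y"
    then show thesis by (intro that[of x c]) (auto simp: U_def)
  qed auto
qed

theorem proposition5p3:
  fixes M :: "real \<Rightarrow> real"
  assumes "orlicz_function M"
    and "\<not> degenerate M"
    and "twice_differentiable_pos M"
    and "Delta2_at_zero M"
    and "filterlim (deriv (deriv M)) at_top (at_right 0)"
  shows "\<not> (\<exists>b. bump (orlicz_space M) (orlicz_norm M) b \<and>
                nontrivial_on (orlicz_space M) b \<and>
                twice_gateaux_differentiable (orlicz_space M) (orlicz_norm M) b)"
proof (rule notI, elim exE conjE)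
  fix b
  assume bump: "bump (orlicz_space M) (orlicz_norm M) b"
    and nontrivial: "nontrivial_on (orlicz_space M) b"
    and "twice_gateaux_differentiable (orlicz_space M) (orlicz_norm M) b"
  then obtain b' b'' where b': "has_gateaux_derivative (orlicz_space M) (orlicz_norm M) b b'"
    and b'': "\<And>x. x \<in> orlicz_space M \<Longrightarrow>
        bounded_bilinear_form (orlicz_space M) (orlicz_norm M) (b'' x)"
      "\<And>x h k. \<lbrakk>x \<in> orlicz_space M; h \<in> orlicz_space M; k \<in> orlicz_space M\<rbrakk> \<Longrightarrow>
        ((\<lambda>t. (b' (\<lambda>n. x n + t * k n) h - b' x h) / t) \<longlongrightarrow> b'' x h k) (at 0)"
    unfolding twice_gateaux_differentiable_def by blast
  note M = assms(1,2,4)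
  note e_space = unit_vector_in_orlicz_space[OF M]
  obtain x c where x: "x \<in> orlicz_space M" "b x \<noteq> 0"
    and c: "\<And>n. 1 / 2 \<le> c n" "\<And>n. c n \<le> 1"
    and min: "\<And>y. y \<in> orlicz_space M \<Longrightarrow> b y \<noteq> 0 \<Longrightarrow>
      1 / (b x)\<^sup>2 - weighted_modular M c x \<le> 1 / (b y)\<^sup>2 - weighted_modular M c y"
    using bump_perturbed_minimum[OF M bump nontrivial] by blast
  have c_abs: "\<bar>c n\<bar> \<le> 1" for n using c[of n] by simp
  define E where "E = orlicz_norm M (unit_vector 0)"
  obtain C1 where C1: "\<And>h. h \<in> orlicz_space M \<Longrightarrow> \<bar>b' x h\<bar> \<le> C1 * orlicz_norm M h"
    using b' x(1) unfolding has_gateaux_derivative_def dual_space_def by blast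
  obtain C2 where C2: "\<And>h k. h \<in> orlicz_space M \<Longrightarrow> k \<in> orlicz_space M \<Longrightarrow>
      \<bar>b'' x h k\<bar> \<le> C2 * orlicz_norm M h * orlicz_norm M k"
    using b''(1)[OF x(1)] unfolding bounded_bilinear_form_def by blast
  \<comment> \<open>Bounds the second derivative of \<open>1 / b\<^sup>2\<close> at \<open>x\<close>
    along every unit vector, uniformly in \<open>n\<close>, since all unit vectors have norm
    \<open>E\<close>.\<close>
  define C0 where "C0 = 6 * (C1 * E)\<^sup>2 / (b x) ^ 4 + 2 * (C2 * E * E) / \<bar>b x\<bar> ^ 3"
  have D_le: "6 * (b' x (unit_vector n))\<^sup>2 / (b x) ^ 4
      - 2 * b'' x (unit_vector n) (unit_vector n) / (b x) ^ 3 \<le> C0" for n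
  proof -
    have norm: "orlicz_norm M (unit_vector n) = E"
      unfolding E_def by (rule orlicz_norm_unit_vector[OF M])
    have "\<bar>b' x (unit_vector n)\<bar> \<le> C1 * E" using C1[OF e_space, of n] by (simp add: norm)
    then have "(b' x (unit_vector n))\<^sup>2 \<le> (C1 * E)\<^sup>2"
      by (metis abs_ge_zero power2_abs power_mono)
    then have 1: "6 * (b' x (unit_vector n))\<^sup>2 / (b x) ^ 4 \<le> 6 * (C1 * E)\<^sup>2 / (b x) ^ 4"
      by (intro divide_right_mono) auto
    have "- (2 * b'' x (unit_vector n) (unit_vector n) / (b x) ^ 3)
        \<le> \<bar>2 * b'' x (unit_vector n) (unit_vector n) / (b x) ^ 3\<bar>"
      by (rule abs_ge_minus_self)
    also have "\<dots> = 2 * \<bar>b'' x (unit_vector n) (unit_vector n)\<bar> / \<bar>b x\<bar> ^ 3"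
      by (simp add: abs_mult power_abs)
    also have "\<dots> \<le> 2 * (C2 * E * E) / \<bar>b x\<bar> ^ 3"
      using C2[OF e_space e_space, of n n] by (intro divide_right_mono) (auto simp: norm)
    finally show ?thesis using 1 unfolding C0_def by linarith
  qed
  \<comment> \<open>Chosen so that \<open>K / 2 = C0 + 1\<close> exceeds \<open>C0\<close>.
    Truncation at 0 in \<open>K'\<close> makes the later multiplication of
    \<open>c n \<ge> 1 / 2\<close> by \<open>K' * t\<^sup>2\<close> preserve the inequality.\<close>
  define K where "K = 2 * C0 + 2"
  define K' where "K' = max K 0"
  have "\<forall>\<^sub>F t in at_right 0. K' \<le> deriv (deriv M) t"
    using assms(5) by (simp add: filterlim_at_top)
  then obtain \<eta> where \<eta>: "\<eta> > 0" "\<And>t. 0 < t \<Longrightarrow> t < \<eta> \<Longrightarrow> K' \<le> deriv (deriv M) t"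
    by (auto simp: eventually_at_right_field)
  obtain n where n: "\<bar>x n\<bar> < \<eta>"
    using LIMSEQ_D[OF orlicz_space_tendsto_zero[OF M x(1)] \<eta>(1)] by auto
  have M_derivs: "(M has_real_derivative deriv M t) (at t)"
    "(deriv M has_real_derivative deriv (deriv M) t) (at t)" if "0 < t" "t < \<eta>" for t
    using assms(3) that
    by (auto simp: twice_differentiable_pos_def DERIV_deriv_iff_real_differentiable)
  have "mono_on {0..} M" "M 0 = 0" using assms(1) by (auto simp: orlicz_function_def)
  from second_difference_ge[OF M_derivs \<eta>(2) this n] obtain d1 where d1: "d1 > 0"
    "\<And>t. 0 < t \<Longrightarrow> t < d1 \<Longrightarrow> K' * t\<^sup>2 \<le> M \<bar>x n + t\<bar> + M \<bar>x n - t\<bar> - 2 * M \<bar>x n\<bar>"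
    by blast
  define y where "y = (\<lambda>t i. x i + t * unit_vector n i)"
  have y_space: "y t \<in> orlicz_space M" for t
    unfolding y_def by (rule line_in_orlicz_space[OF M x(1)])
  have y0: "y 0 = x" by (simp add: y_def)
  have y_add: "y (t + s) = (\<lambda>i. y t i + s * unit_vector n i)" for s t
    by (simp add: y_def algebra_simps)
  \<comment> \<open>By \<open>y_add\<close>, the Gateaux derivative at \<open>y t\<close> is the
    ordinary derivative along the line at every parameter \<open>t\<close>.\<close>
  have g: "((\<lambda>t. b (y t)) has_real_derivative b' (y t) (unit_vector n)) (at t)" for t
    using b' y_space[of t] e_space[of n]
    unfolding DERIV_def y_add has_gateaux_derivative_def by blast
  have g1: "((\<lambda>t. b' (y t) (unit_vector n)) has_real_derivative
      b'' x (unit_vector n) (unit_vector n)) (at 0)"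
    using b''(2)[OF x(1) e_space e_space, of n n] unfolding DERIV_def y_add y0 .
  obtain d where d: "d > 0" "\<And>t. \<bar>t\<bar> < d \<Longrightarrow> b (y t) \<noteq> 0"
    "\<And>t. \<bar>t\<bar> < d \<Longrightarrow> ((\<lambda>t. 1 / (b (y t))\<^sup>2) has_real_derivative
       - 2 * b' (y t) (unit_vector n) / (b (y t)) ^ 3) (at t)"
    "((\<lambda>t. - 2 * b' (y t) (unit_vector n) / (b (y t)) ^ 3) has_real_derivative
        6 * (b' x (unit_vector n))\<^sup>2 / (b x) ^ 4
        - 2 * b'' x (unit_vector n) (unit_vector n) / (b x) ^ 3) (at 0)"
    using has_second_derivative_inverse_square[OF g g1] x(2) unfolding y0 by blast
  have "K' / 2 \<le> 6 * (b' x (unit_vector n))\<^sup>2 / (b x) ^ 4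
        - 2 * b'' x (unit_vector n) (unit_vector n) / (b x) ^ 3"
  proof (rule second_difference_le_derivative[OF _ d(3) d(4)])
    show "0 < min d d1" using d(1) d1(1) by simp
    fix t assume t: "0 < t" "t < min d d1"
    let ?\<Delta> = "\<lambda>t. M \<bar>x n + t\<bar> - M \<bar>x n\<bar>"
    \<comment> \<open>Minimality of \<open>x\<close> against \<open>y s\<close>, where the two
      modulars differ only in coordinate \<open>n\<close>. Adding the cases \<open>t\<close> and
      \<open>- t\<close> bounds the second difference of \<open>1 / b\<^sup>2\<close> from
      below.\<close>
    have *: "1 / (b x)\<^sup>2 + c n * ?\<Delta> s \<le> 1 / (b (y s))\<^sup>2" if "\<bar>s\<bar> < d" for s
      using min[OF y_space d(2)[OF that]]
        weighted_modular_add_unit_vector[of M x c s n, OF M x(1) c_abs]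
      by (simp add: y_def)
    have "K' / 2 * t\<^sup>2 \<le> c n * (K' * t\<^sup>2)"
      using mult_right_mono[OF c(1)[of n], of "K' * t\<^sup>2"] by (simp add: K'_def)
    also have "\<dots> \<le> c n * (?\<Delta> t + ?\<Delta> (- t))"
      using d1(2)[of t] t c(1)[of n] by (intro mult_left_mono) auto
    also have "\<dots> \<le> 1 / (b (y t))\<^sup>2 + 1 / (b (y (- t)))\<^sup>2 - 2 * (1 / (b (y 0))\<^sup>2)"
      using *[of t] *[of "- t"] t unfolding y0 distrib_left by simp
    finally show "K' / 2 * t\<^sup>2 \<le> 1 / (b (y t))\<^sup>2 + 1 / (b (y (- t)))\<^sup>2 - 2 * (1 / (b (y 0))\<^sup>2)" .
  qed auto
  with D_le[of n] show False by (simp add: K'_def K_def max_def split: if_splits)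
qed

end
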